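(* Let $G$ be a graph with $n$ vertices and $m$ edges, with largest eigenvalue $\lambda_1$ and nullity $\eta(G)=\kappa$, and let $G_1$ be any connected component of $G$, with $n_1\geq 2$ vertices and $m_1$ edges. Then $$\mathcal{E}(G)\ \geq\ \frac{2m_1}{n_1}+n-\kappa-1+\ln\bigl|\Upsilon_{n-\kappa}(G)\bigr|-\ln\frac{2m_1}{n_1}.\qquad ( * )$$ In particular, if $G_1$ is $r_1$-regular, then $$\mathcal{E}(G)\ \geq\ r_1+n-\kappa-1+\ln\bigl|\Upsilon_{n-\kappa}(G)\bigr|-\ln r_1 .$$ If $\lambda_1=1$, then equality holds in $( * )$ if and only if $G=\lfloor\frac{n-\kappa}{2}\rfloor K_2\cup\kappa K_1$. On the contrary, if $\lambda_1>1$, then equality holds in $( * )$ if and only if $G=K_{n-\ell}\cup\kappa K_1\cup\lfloor\frac{\ell-\kappa}{2}\rfloor K_2$ for some $\ell$ with $\kappa\leq\ell\leq n-3$ and $G_1$ is the component $K_{n-\ell}$.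
   Context: Graphs are finite, undirected and simple. The eigenvalues of $G$ are those of its adjacency matrix $A(G)$. The energy $\mathcal{E}(G)$ is the sum of the absolute values of the eigenvalues of $G$, counted with multiplicity. The nullity $\eta(G)$ is the multiplicity of $0$ as an eigenvalue of $A(G)$. For a square matrix $M$ of order $n$ with eigenvalues $\mu_1,\dots,\mu_n$, $\Upsilon_k(M)=\sum_{1\le i_1<\cdots<i_k\le n}\mu_{i_1}\cdots\mu_{i_k}$, and $\Upsilon_{n-\kappa}(G)=\Upsilon_{n-\kappa}(A(G))$. A graph is $r$-regular if every vertex has degree $r$. $K_s$ is the complete graph on $s$ vertices, $tH$ denotes the disjoint union of $t$ copies of $H$ (empty if $t=0$), $\cup$ denotes disjoint union, and equality of graphs means isomorphism. *)

theory Defs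
  imports
    "HOL-Computational_Algebra.Fundamental_Theorem_Algebra"
    "Graph_Theory.Pair_Digraph"
    "Graph_Theory.Digraph_Isomorphism"
    "Jordan_Normal_Form.Char_Poly"
begin

text \<open>
  A finite simple undirected graph is a \<^term>\<open>G\<close> with \<^term>\<open>graph G\<close>: every edge is
  represented by two opposite arcs. Its connected components are the members of
  \<^term>\<open>pre_digraph.sccs G\<close>, since reachability is symmetric in such a graph.
\<close>

definition edges :: "('a, 'b) pre_digraph \<Rightarrow> 'a set set" where
  "edges G = {{u, v} | u v. u \<rightarrow>\<^bsub>G\<^esub> v}"

definition regular_graph :: "nat \<Rightarrow> ('a, 'b) pre_digraph \<Rightarrow> bool" where
  "regular_graph r G \<longleftrightarrow> (\<forall>v\<in>verts G. out_degree G v = r)"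

definition complete_graph :: "nat \<Rightarrow> (nat, nat \<times> nat) pre_digraph" where
  "complete_graph s =
     with_proj \<lparr>pverts = {..<s}, parcs = {(u, v). u < s \<and> v < s \<and> u \<noteq> v}\<rparr>"

definition disjoint_union ::
  "('a, 'b) pre_digraph \<Rightarrow> ('c, 'd) pre_digraph \<Rightarrow> ('a + 'c, 'b + 'd) pre_digraph"
  (infixr "\<uplus>\<^sub>G" 65) where
  "G \<uplus>\<^sub>G H = \<lparr>verts = verts G <+> verts H, arcs = arcs G <+> arcs H,
     tail = map_sum (tail G) (tail H), head = map_sum (head G) (head H)\<rparr>"

definition copies :: "nat \<Rightarrow> ('a, 'b) pre_digraph \<Rightarrow> (nat \<times> 'a, nat \<times> 'b) pre_digraph" where
  "copies t H = \<lparr>verts = {..<t} \<times> verts H, arcs = {..<t} \<times> arcs H,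
     tail = map_prod id (tail H), head = map_prod id (head H)\<rparr>"

text \<open>
  The adjacency matrix is taken with respect to an arbitrary enumeration of the vertices;
  a different enumeration gives a permutation-similar matrix, hence the same spectrum.
\<close>

definition vertex_list :: "('a, 'b) pre_digraph \<Rightarrow> 'a list" where
  "vertex_list G = (SOME vs. distinct vs \<and> set vs = verts G)"

definition adjacency_matrix :: "('a, 'b) pre_digraph \<Rightarrow> complex mat" where
  "adjacency_matrix G = (let vs = vertex_list G; n = length vs in
     mat n n (\<lambda>(i, j). if vs ! i \<rightarrow>\<^bsub>G\<^esub> vs ! j then 1 else 0))"

definition eigenvalues :: "complex mat \<Rightarrow> complex multiset" where
  "eigenvalues M = proots (char_poly M)"

definition eigenvalue_list :: "complex mat \<Rightarrow> complex list" where
  "eigenvalue_list M = (SOME \<mu>. mset \<mu> = eigenvalues M)"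

definition Upsilon :: "nat \<Rightarrow> complex mat \<Rightarrow> complex" where
  "Upsilon k M = (\<Sum>I | I \<subseteq> {..<dim_row M} \<and> card I = k. \<Prod>i\<in>I. eigenvalue_list M ! i)"

definition energy :: "('a, 'b) pre_digraph \<Rightarrow> real" where
  "energy G = (\<Sum>\<mu>\<in>#eigenvalues (adjacency_matrix G). cmod \<mu>)"

definition nullity :: "('a, 'b) pre_digraph \<Rightarrow> nat" where
  "nullity G = count (eigenvalues (adjacency_matrix G)) 0"

definition largest_eigenvalue :: "('a, 'b) pre_digraph \<Rightarrow> real" where
  "largest_eigenvalue G =
     Max {x :: real. complex_of_real x \<in># eigenvalues (adjacency_matrix G)}"

lemma vertex_list:
  assumes "finite (verts G)"
  shows "distinct (vertex_list G)" "set (vertex_list G) = verts G"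
proof -
  have "\<exists>vs. distinct vs \<and> set vs = verts G"
    using finite_distinct_list[OF assms] by blast
  from someI_ex[OF this]
  show "distinct (vertex_list G)" "set (vertex_list G) = verts G"
    unfolding vertex_list_def by auto
qed

lemma mset_eigenvalue_list: "mset (eigenvalue_list M) = eigenvalues M"
  unfolding eigenvalue_list_def by (rule someI_ex) (rule ex_mset)

lemma length_eigenvalue_list:
  assumes "M \<in> carrier_mat n n"
  shows "length (eigenvalue_list M) = n"
proof -
  have "length (eigenvalue_list M) = size (eigenvalues M)"
    by (metis mset_eigenvalue_list size_mset)
  also have "\<dots> = degree (char_poly M)"
    unfolding eigenvalues_def by (rule size_proots_complex)
  also have "\<dots> = n"
    using degree_monic_char_poly[OF assms] by simp
  finally show ?thesis .
qed

lemma adjacency_matrix_carrier: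
  assumes "finite (verts G)"
  shows "adjacency_matrix G \<in> carrier_mat (card (verts G)) (card (verts G))"
  using vertex_list[OF assms] distinct_card[of "vertex_list G"]
  by (auto simp: adjacency_matrix_def Let_def)

lemma graph_complete_graph: "graph (complete_graph s)"
proof -
  have "pair_graph \<lparr>pverts = {..<s}, parcs = {(u, v). u < s \<and> v < s \<and> u \<noteq> v}\<rparr>"
  proof
    show "finite (parcs \<lparr>pverts = {..<s}, parcs = {(u, v). u < s \<and> v < s \<and> u \<noteq> v}\<rparr>)"
      by (rule finite_subset[of _ "{..<s} \<times> {..<s}"]) auto
  qed (auto simp: symmetric_def sym_def)
  then show ?thesis
    unfolding complete_graph_def by (rule pair_graph.pair_graphD_graph)
qed

end

(*
  With T the multiset of eigenvalues other than one copy of lambda_1, and d = 2 m_1 / n_1,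

    energy - bound = (lambda_1 - ln lambda_1) - (d - ln d)
                     + (sum of |x| - 1 - ln |x| over the nonzero x in T),

  where every term is nonnegative because 1 <= d <= lambda_1. Equality forces d = lambda_1 and
  T inside {-1, 0, 1}. Then A + I is positive semidefinite, so G has no induced path on three
  vertices and is a disjoint union of cliques. Here G_1 is a clique on s = lambda_1 + 1 vertices,
  and tr (A^3 - A) = lambda_1^3 - lambda_1 = s (s - 1) (s - 2) shows that it contains every
  triangle. The trace of A^2 finally counts the isolated vertices. In the converse direction the
  same trace shows that s - 1 is a simple eigenvalue.
*)
theory Submission
  imports Defs "Jordan_Normal_Form.Schur_Decomposition" "HOL-Analysis.Convex"
begin

unbundle no inner_syntax

section \<open>Matrices\<close>

text \<open>Two facts about spectra carry the argument: power sums of eigenvalues are traces of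
  powers, and a one-sided bound on the eigenvalues bounds the quadratic form. The first comes from
  complex Schur triangularization. The second is derived from the first: traces of high even powers
  control the quadratic form up to the factor n, which is negligible against geometric growth. Test
  vectors then do the combinatorics: the indicator vector of the component gives d \<le>
  \<open>lambda\<^sub>1\<close>, and the vector (1, -1, 1) on an induced path contradicts positive
  semidefiniteness. In a disjoint union of one clique with edges and points, the eigenvector
  equation yields only the set of possible eigenvalues. This is why multiplicities are always read
  off from the second moment. The case \<open>lambda\<^sub>1 = 1\<close> is degenerate: equality and
  the isomorphism both hold for every such G, and the equivalence follows from that.\<close>

abbreviation mat_trace :: "'a :: comm_monoid_add mat \<Rightarrow> 'a" where
  "mat_trace A \<equiv> \<Sum>i<dim_row A. A $$ (i, i)"

section \<open>Traces of powers as power sums of eigenvalues\<close>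

lemma index_mult_mat_sum:
  assumes "A \<in> carrier_mat n k" "B \<in> carrier_mat k m" "i < n" "j < m"
  shows "(A * B) $$ (i, j) = (\<Sum>l<k. A $$ (i, l) * B $$ (l, j))"
  using assms by (auto simp: scalar_prod_def atLeast0LessThan intro!: sum.cong)

lemma index_mult_mat_vec_sum:
  assumes "A \<in> carrier_mat n k" "v \<in> carrier_vec k" "i < n"
  shows "(A *\<^sub>v v) $ i = (\<Sum>l<k. A $$ (i, l) * v $ l)"
  using assms by (auto simp: scalar_prod_def atLeast0LessThan intro!: sum.cong)

lemma trace_mult_commute:
  fixes A B :: "'a :: comm_semiring_0 mat"
  assumes A: "A \<in> carrier_mat n m" and B: "B \<in> carrier_mat m n"
  shows "mat_trace (A * B) = mat_trace (B * A)"
proof -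
  have "mat_trace (A * B) = (\<Sum>i<n. \<Sum>j<m. A $$ (i, j) * B $$ (j, i))"
    using A B by (auto simp: index_mult_mat_sum[OF A B] simp del: index_mult_mat(1))
  also have "\<dots> = (\<Sum>j<m. \<Sum>i<n. B $$ (j, i) * A $$ (i, j))"
    by (subst sum.swap) (simp add: mult.commute)
  also have "\<dots> = mat_trace (B * A)"
    using A B by (auto simp: index_mult_mat_sum[OF B A] simp del: index_mult_mat(1))
  finally show ?thesis .
qed

lemma trace_similar:
  fixes A B :: "'a :: comm_ring_1 mat"
  assumes A: "A \<in> carrier_mat n n" and sim: "similar_mat_wit A B P Q"
  shows "mat_trace A = mat_trace B"
proof -
  note s = similar_mat_witD2[OF A sim]
  have "mat_trace A = mat_trace (P * (B * Q))"
    using s(3) assoc_mult_mat[OF s(6,5,7)] by simp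
  also have "\<dots> = mat_trace ((B * Q) * P)"
    using s by (intro trace_mult_commute[of _ n n]) auto
  also have "(B * Q) * P = B"
    using s(2,5) assoc_mult_mat[OF s(5,7,6)] by simp
  finally show ?thesis .
qed

lemma upper_triangular_pow:
  fixes B :: "'a :: comm_semiring_1 mat"
  assumes B: "B \<in> carrier_mat n n" and ut: "upper_triangular B"
  shows "upper_triangular (B ^\<^sub>m k) \<and> (\<forall>i<n. (B ^\<^sub>m k) $$ (i, i) = B $$ (i, i) ^ k)"
proof (induction k)
  case 0
  then show ?case using B by auto
next
  case (Suc k)
  let ?C = "B ^\<^sub>m k"
  have C: "?C \<in> carrier_mat n n" using B by simp
  \<comment> \<open>At or below the diagonal, \<open>?C $$ (i, l)\<close> vanishes for l < i and
    \<open>B $$ (l, j)\<close> for l > j. With j \<le> i only l = i = j survives.\<close>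
  have prod: "?C $$ (i, l) * B $$ (l, j) = (if l = i \<and> i = j then B $$ (i, i) ^ Suc k else 0)"
    if ij: "i < n" "j \<le> i" "l < n" for i j l
  proof -
    consider "l < i" | "l = i" "j < i" | "l = i" "j = i" | "l > i" using ij(2) by linarith
    then show ?thesis
    proof cases
      case 1
      then have "?C $$ (i, l) = 0" using Suc ij C by (auto simp: upper_triangular_def)
      then show ?thesis using 1 by simp
    next
      case 2
      then have "B $$ (l, j) = 0" using ij ut B by (auto simp: upper_triangular_def)
      then show ?thesis using 2 by simp
    next
      case 3
      then show ?thesis using ij Suc by (simp add: mult.commute)
    next
      case 4
      then have "B $$ (l, j) = 0" using ij ut B by (auto simp: upper_triangular_def)
      then show ?thesis using 4 by simp
    qed
  qed
  have ent: "(?C * B) $$ (i, j) = (if i = j then B $$ (i, i) ^ Suc k else 0)"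
    if "i < n" "j \<le> i" for i j
  proof -
    have "j < n" using that by simp
    then have "(?C * B) $$ (i, j) = (\<Sum>l<n. if l = i \<and> i = j then B $$ (i, i) ^ Suc k else 0)"
      unfolding index_mult_mat_sum[OF C B that(1) \<open>j < n\<close>] using that
      by (intro sum.cong refl prod) auto
    also have "\<dots> = (if i = j then B $$ (i, i) ^ Suc k else 0)"
      using that by (cases "i = j") (simp_all add: sum.delta)
    finally show ?thesis .
  qed
  show ?case
    using ent B by (auto intro!: upper_triangularI simp del: index_mult_mat(1))
qed

text \<open>\<open>schur_decomposition\<close> expects a list over which the characteristic
  polynomial splits. \<open>eigenvalue_list\<close> is an arbitrary enumeration of the root
  multiset; it qualifies because a product of linear factors ignores their order.\<close>

lemma char_poly_eigenvalue_list:
  assumes A: "A \<in> carrier_mat n n"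
  shows "char_poly A = (\<Prod>e\<leftarrow>eigenvalue_list A. [:- e, 1:])"
proof -
  have "char_poly A \<noteq> 0" using degree_monic_char_poly[OF A] by auto
  obtain es where es: "char_poly A = (\<Prod>e\<leftarrow>es. [:- e, 1:])"
    using char_poly_factorized[OF A] by blast
  have "proots (\<Prod>e\<leftarrow>es. [:- e, 1:]) = mset es"
  proof (induction es)
    case (Cons e es)
    have "(\<Prod>e\<leftarrow>es. [:- e, 1:]) \<noteq> 0" by (induction es) (auto simp del: mult_pCons_left)
    then have "proots ([:- e, 1:] * (\<Prod>e\<leftarrow>es. [:- e, 1:]))
        = proots [:- e, 1:] + proots (\<Prod>e\<leftarrow>es. [:- e, 1:])"
      by (intro proots_mult) auto
    then show ?case using Cons by (simp del: mult_pCons_left)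
  qed simp
  then have "mset es = mset (eigenvalue_list A)"
    by (simp add: mset_eigenvalue_list eigenvalues_def es)
  then have "(\<Prod>e\<in>#mset es. [:- e, 1:]) = (\<Prod>e\<in>#mset (eigenvalue_list A). [:- e, 1:])"
    by simp
  then show ?thesis unfolding es by (simp flip: mset_map add: prod_mset_prod_list)
qed

text \<open>Schur triangularization puts the eigenvalues on the diagonal of an upper triangular
  matrix. Powers act entrywise on that diagonal, and similarity preserves the trace.\<close>

lemma trace_pow_eigenvalues:
  assumes A: "A \<in> carrier_mat n n"
  shows "mat_trace (A ^\<^sub>m k) = (\<Sum>\<mu>\<in>#eigenvalues A. \<mu> ^ k)"
proof -
  let ?es = "eigenvalue_list A"
  obtain B P Q where sd: "schur_decomposition A ?es = (B, P, Q)"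
    by (cases "schur_decomposition A ?es") auto
  from schur_decomposition[OF A char_poly_eigenvalue_list[OF A] sd]
  have sim: "similar_mat_wit A B P Q" and ut: "upper_triangular B" and dg: "diag_mat B = ?es"
    by auto
  note s = similar_mat_witD2[OF A sim]
  have "mat_trace (A ^\<^sub>m k) = mat_trace (B ^\<^sub>m k)"
    using A similar_mat_wit_pow[OF sim] by (intro trace_similar[of _ n]) auto
  also have "\<dots> = (\<Sum>i<n. B $$ (i, i) ^ k)"
    using upper_triangular_pow[OF s(5) ut, of k] s(5) by simp
  also have "\<dots> = (\<Sum>\<mu>\<leftarrow>diag_mat B. \<mu> ^ k)"
    using s(5) by (simp add: diag_mat_def o_def sum_list_distinct_conv_sum_set atLeast0LessThan)
  also have "\<dots> = (\<Sum>\<mu>\<in>#eigenvalues A. \<mu> ^ k)"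
    unfolding dg by (simp flip: mset_eigenvalue_list mset_map add: sum_mset_sum_list)
  finally show ?thesis .
qed

lemma in_eigenvalues_iff:
  assumes A: "A \<in> carrier_mat n n"
  shows "\<mu> \<in># eigenvalues A \<longleftrightarrow> eigenvalue A \<mu>"
proof -
  have "char_poly A \<noteq> 0" using degree_monic_char_poly[OF A] by auto
  then show ?thesis
    unfolding eigenvalues_def by (simp add: eigenvalue_root_char_poly[OF A])
qed

lemma norm_sum_mset_le:
  fixes f :: "'a \<Rightarrow> 'b :: real_normed_vector"
  shows "norm (\<Sum>x\<in>#M. f x) \<le> (\<Sum>x\<in>#M. norm (f x))"
  by (induction M) (auto intro: order_trans[OF norm_triangle_ineq])

section \<open>Rayleigh quotients of symmetric matrices from traces of powers\<close>

abbreviation complex_mat :: "real mat \<Rightarrow> complex mat" where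
  "complex_mat \<equiv> map_mat complex_of_real"

lemma pow_mat_add:
  fixes A :: "'a :: semiring_1 mat"
  assumes A: "A \<in> carrier_mat n n"
  shows "A ^\<^sub>m (k + l) = A ^\<^sub>m k * A ^\<^sub>m l"
proof (induction l)
  case (Suc l)
  have "A ^\<^sub>m k * A ^\<^sub>m Suc l = A ^\<^sub>m k * A ^\<^sub>m l * A"
    using A by (simp add: assoc_mult_mat[of _ n n _ n _ n])
  then show ?case using Suc by simp
qed (use A in simp)

context
  fixes R :: "real mat" and n :: nat
  assumes R: "R \<in> carrier_mat n n" and sym: "R\<^sup>T = R"
begin
unbundle no inner_syntax

lemma transpose_pow_symmetric: "(R ^\<^sub>m k)\<^sup>T = R ^\<^sub>m k"
proof (induction k)
  case 0
  then show ?case using R by simp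
next
  case (Suc k)
  have C: "R ^\<^sub>m k \<in> carrier_mat n n" using R by simp
  have "(R ^\<^sub>m Suc k)\<^sup>T = R * R ^\<^sub>m k"
    using Suc sym by (simp add: transpose_mult[OF C R])
  also have "\<dots> = R ^\<^sub>m Suc k"
    using pow_mat_add[OF R, of 1 k] R by simp
  finally show ?case .
qed

lemma scalar_prod_pow_double:
  assumes x: "x \<in> carrier_vec n"
  shows "x \<bullet> (R ^\<^sub>m (k + k) *\<^sub>v x) = (R ^\<^sub>m k *\<^sub>v x) \<bullet> (R ^\<^sub>m k *\<^sub>v x)"
proof -
  let ?C = "R ^\<^sub>m k"
  have C: "?C \<in> carrier_mat n n" using R by simp
  have "R ^\<^sub>m (k + k) = ?C * ?C"
    using pow_mat_add[OF R] by simp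
  then have "x \<bullet> (R ^\<^sub>m (k + k) *\<^sub>v x) = x \<bullet> (?C *\<^sub>v (?C *\<^sub>v x))"
    using assoc_mult_mat_vec[OF C C x] by simp
  also have "\<dots> = (?C\<^sup>T *\<^sub>v x) \<bullet> (?C *\<^sub>v x)"
    using C x by (subst transpose_vec_mult_scalar[OF C]) auto
  finally show ?thesis using transpose_pow_symmetric by simp
qed

text \<open>Cauchy-Schwarz in each row bounds the left side by the squared Frobenius norm of
  \<open>R ^\<^sub>m k\<close> times \<open>x \<bullet> x\<close>. By symmetry this squared norm is
  the trace of the square of \<open>R ^\<^sub>m k\<close>.\<close>

lemma sum_squares_pow_le_trace:
  assumes x: "x \<in> carrier_vec n"
  shows "(R ^\<^sub>m k *\<^sub>v x) \<bullet> (R ^\<^sub>m k *\<^sub>v x) \<le> mat_trace (R ^\<^sub>m (k + k)) * (x \<bullet> x)"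
proof -
  let ?C = "R ^\<^sub>m k"
  have C: "?C \<in> carrier_mat n n" using R by simp
  have sym_C: "?C $$ (i, j) = ?C $$ (j, i)" if "i < n" "j < n" for i j
    using transpose_pow_symmetric[of k] that C by (metis carrier_matD index_transpose_mat(1))
  have "(?C *\<^sub>v x) \<bullet> (?C *\<^sub>v x) = (\<Sum>i<n. (\<Sum>l<n. ?C $$ (i, l) * x $ l)\<^sup>2)"
    using C x
    by (auto simp: scalar_prod_def[of "?C *\<^sub>v x"] atLeast0LessThan power2_eq_square
        index_mult_mat_vec_sum[OF C x] simp del: index_mult_mat_vec intro!: sum.cong)
  also have "\<dots> \<le> (\<Sum>i<n. (\<Sum>l<n. (?C $$ (i, l))\<^sup>2) * (\<Sum>l<n. (x $ l)\<^sup>2))"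
    by (intro sum_mono Cauchy_Schwarz_ineq_sum)
  also have "\<dots> = (\<Sum>i<n. \<Sum>l<n. (?C $$ (i, l))\<^sup>2) * (x \<bullet> x)"
    using x by (simp add: sum_distrib_right scalar_prod_def atLeast0LessThan power2_eq_square)
  also have "(\<Sum>i<n. \<Sum>l<n. (?C $$ (i, l))\<^sup>2) = (\<Sum>i<n. (?C * ?C) $$ (i, i))"
    by (auto simp: index_mult_mat_sum[OF C C] power2_eq_square sym_C simp del: index_mult_mat(1)
        intro!: sum.cong)
  also have "\<dots> = mat_trace (R ^\<^sub>m (k + k))"
    using R by (simp add: pow_mat_add[OF R] del: index_mult_mat(1))
  finally show ?thesis .
qed

text \<open>
  Rayleigh quotients are bounded by the spectral radius without diagonalizing: squaring the
  quotient repeatedly gives \<open>q ^ (2 ^ j) \<le> trace (R ^ (2 ^ j)) \<le> n * \<rho> ^ (2 ^ j)\<close> for all \<open>j\<close>.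
\<close>
lemma rayleigh_pow_le_trace:
  assumes x: "x \<in> carrier_vec n" and unit: "x \<bullet> x = 1"
  shows "(x \<bullet> (R *\<^sub>v x)) ^ (2 ^ Suc j) \<le> mat_trace (R ^\<^sub>m (2 ^ Suc j))"
proof -
  \<comment> \<open>Cauchy-Schwarz for the unit vector x and
    \<open>R ^\<^sub>m k *\<^sub>v x\<close>: doubling the exponent at least squares the
    moment.\<close>
  have cs: "(x \<bullet> (R ^\<^sub>m k *\<^sub>v x))\<^sup>2 \<le> x \<bullet> (R ^\<^sub>m (k + k) *\<^sub>v x)" for k
  proof -
    define y where "y = R ^\<^sub>m k *\<^sub>v x"
    have y: "y \<in> carrier_vec n"
      unfolding y_def by (rule mult_mat_vec_carrier[OF pow_carrier_mat[OF R] x])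
    have "(x \<bullet> y)\<^sup>2 \<le> (x \<bullet> x) * (y \<bullet> y)"
      using Cauchy_Schwarz_ineq_sum[of "\<lambda>i. x $ i" "\<lambda>i. y $ i" "{0..<n}"] x y
      by (simp add: scalar_prod_def power2_eq_square)
    then show ?thesis using scalar_prod_pow_double[OF x, of k] unit by (simp add: y_def)
  qed
  have "(x \<bullet> (R *\<^sub>v x)) ^ (2 ^ Suc j) \<le> x \<bullet> (R ^\<^sub>m (2 ^ Suc j) *\<^sub>v x)"
  proof (induction j)
    case 0
    show ?case using cs[of 1] R by (simp add: numeral_2_eq_2)
  next
    case (Suc j)
    have "(x \<bullet> (R *\<^sub>v x)) ^ (2 ^ Suc (Suc j)) = ((x \<bullet> (R *\<^sub>v x)) ^ (2 ^ Suc j))\<^sup>2"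
      by (metis power_Suc2 power_mult)
    \<comment> \<open>The left side of the induction hypothesis is an even power and hence
      nonnegative, so squaring preserves the inequality. This is why the exponents start at
      2.\<close>
    also have "\<dots> \<le> (x \<bullet> (R ^\<^sub>m (2 ^ Suc j) *\<^sub>v x))\<^sup>2"
      using Suc by (intro power_mono) (simp_all add: power_mult)
    also have "\<dots> \<le> x \<bullet> (R ^\<^sub>m (2 ^ Suc (Suc j)) *\<^sub>v x)"
      using cs[of "2 ^ Suc j"] by (simp add: mult_2)
    finally show ?case .
  qed
  also have "\<dots> \<le> mat_trace (R ^\<^sub>m (2 ^ Suc j))"
    using sum_squares_pow_le_trace[OF x, of "2 ^ j"] scalar_prod_pow_double[OF x, of "2 ^ j"] unit
    by (simp add: mult_2)
  finally show ?thesis .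
qed

text \<open>A unit vector with quotient q > \<rho> would give (q / \<rho>) ^ (2 ^ j) \<le> n for all
  j \<ge> 1, against geometric growth. Other nonzero vectors are normalized first.\<close>

lemma rayleigh_le_spectral_bound:
  assumes x: "x \<in> carrier_vec n"
    and \<rho>: "\<rho> > 0" "\<And>\<mu>. \<mu> \<in># eigenvalues (complex_mat R) \<Longrightarrow> cmod \<mu> \<le> \<rho>"
  shows "\<bar>x \<bullet> (R *\<^sub>v x)\<bar> \<le> \<rho> * (x \<bullet> x)"
proof -
  have unit: "\<bar>x \<bullet> (R *\<^sub>v x)\<bar> \<le> \<rho>" if x: "x \<in> carrier_vec n" and unit: "x \<bullet> x = 1" for x
  proof (rule ccontr)
    assume neg: "\<not> ?thesis"
    define q where "q = \<bar>x \<bullet> (R *\<^sub>v x)\<bar>"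
    have CR: "complex_mat R \<in> carrier_mat n n" using R by simp
    have "(q / \<rho>) ^ (2 ^ Suc j) \<le> real n" for j
    proof -
      let ?k = "2 ^ Suc j"
      have "q ^ ?k \<le> mat_trace (R ^\<^sub>m ?k)"
        using rayleigh_pow_le_trace[OF x unit, of j] by (simp add: q_def power_even_abs)
      also have "complex_of_real \<dots> = mat_trace (complex_mat R ^\<^sub>m ?k)"
        using R pow_carrier_mat[OF R, of ?k] by (simp flip: of_real_hom.mat_hom_pow[OF R])
      then have "mat_trace (R ^\<^sub>m ?k) = Re (\<Sum>\<mu>\<in>#eigenvalues (complex_mat R). \<mu> ^ ?k)"
        unfolding trace_pow_eigenvalues[OF CR] by (metis Re_complex_of_real)
      also have "\<dots> \<le> cmod (\<Sum>\<mu>\<in>#eigenvalues (complex_mat R). \<mu> ^ ?k)"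
        by (rule complex_Re_le_cmod)
      also have "\<dots> \<le> (\<Sum>\<mu>\<in>#eigenvalues (complex_mat R). cmod (\<mu> ^ ?k))"
        by (rule norm_sum_mset_le)
      also have "\<dots> \<le> (\<Sum>\<mu>\<in>#eigenvalues (complex_mat R). \<rho> ^ ?k)"
        using \<rho> by (intro sum_mset_mono) (auto simp: norm_power intro!: power_mono)
      also have "\<dots> = real n * \<rho> ^ ?k"
        using length_eigenvalue_list[OF CR] by (simp flip: mset_eigenvalue_list)
      finally show ?thesis using \<rho> by (simp add: power_divide field_simps)
    qed
    moreover have "q / \<rho> > 1" using neg \<rho> by (simp add: q_def)
    then obtain j where "real n < (q / \<rho>) ^ j" using real_arch_pow by blast
    moreover have "(q / \<rho>) ^ j \<le> (q / \<rho>) ^ (2 ^ Suc j)"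
      using \<open>q / \<rho> > 1\<close> less_exp[of "Suc j"] by (intro power_increasing) auto
    ultimately show False by (meson leD order_trans)
  qed
  show ?thesis
  proof (cases "x \<bullet> x = 0")
    case True
    then have "\<forall>i\<in>{0..<n}. x $ i * x $ i = 0"
      using x by (subst sum_nonneg_eq_0_iff[symmetric]) (auto simp: scalar_prod_def)
    then have "x = 0\<^sub>v n" using x by (intro eq_vecI) auto
    then show ?thesis using R by simp
  next
    case False
    define c where "c = sqrt (x \<bullet> x)"
    have "x \<bullet> x \<ge> 0" by (auto simp: scalar_prod_def intro!: sum_nonneg)
    then have c: "c > 0" "c * c = x \<bullet> x" using False by (auto simp: c_def)
    define y where "y = (1 / c) \<cdot>\<^sub>v x"
    have y: "y \<in> carrier_vec n" and xy: "x = c \<cdot>\<^sub>v y" using x c by (auto simp: y_def)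
    have "y \<bullet> y = 1" using x c False by (simp add: y_def)
    then have "\<bar>y \<bullet> (R *\<^sub>v y)\<bar> \<le> \<rho>" using unit y by blast
    moreover have "x \<bullet> (R *\<^sub>v x) = (c * c) * (y \<bullet> (R *\<^sub>v y))"
      using y R by (simp add: xy mult_mat_vec[OF R y])
    ultimately show ?thesis using c \<open>x \<bullet> x \<ge> 0\<close>
      by (simp add: abs_mult mult_left_mono mult.commute[of \<rho>])
  qed
qed

end

section \<open>One-sided bounds by an affine shift\<close>

lemma affine_mult_mat_vec:
  fixes A :: "'a :: comm_ring_1 mat"
  assumes A: "A \<in> carrier_mat n n" and v: "v \<in> carrier_vec n"
  shows "(a \<cdot>\<^sub>m A + c \<cdot>\<^sub>m 1\<^sub>m n) *\<^sub>v v = a \<cdot>\<^sub>v (A *\<^sub>v v) + c \<cdot>\<^sub>v v"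
proof (rule eq_vecI)
  fix i assume "i < dim_vec (a \<cdot>\<^sub>v (A *\<^sub>v v) + c \<cdot>\<^sub>v v)"
  then have i: "i < n" using v by simp
  have B: "a \<cdot>\<^sub>m A + c \<cdot>\<^sub>m 1\<^sub>m n \<in> carrier_mat n n" using A by simp
  have "((a \<cdot>\<^sub>m A + c \<cdot>\<^sub>m 1\<^sub>m n) *\<^sub>v v) $ i
      = (\<Sum>l<n. (a * A $$ (i, l)) * v $ l + (if l = i then c * v $ i else 0))"
    unfolding index_mult_mat_vec_sum[OF B v i] using A i by (intro sum.cong) (auto simp: distrib_right)
  also have "\<dots> = a * (\<Sum>l<n. A $$ (i, l) * v $ l) + c * v $ i"
    using i by (simp add: sum.distrib sum_distrib_left mult.assoc)
  also have "\<dots> = (a \<cdot>\<^sub>v (A *\<^sub>v v) + c \<cdot>\<^sub>v v) $ i"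
    using A v i by (simp add: index_mult_mat_vec_sum[OF A v i] del: index_mult_mat_vec)
  finally show "((a \<cdot>\<^sub>m A + c \<cdot>\<^sub>m 1\<^sub>m n) *\<^sub>v v) $ i = (a \<cdot>\<^sub>v (A *\<^sub>v v) + c \<cdot>\<^sub>v v) $ i" .
qed (use A v in auto)

lemma eigenvalue_affine:
  fixes A :: "complex mat"
  assumes A: "A \<in> carrier_mat n n" and a: "a \<noteq> 0"
    and ev: "\<mu> \<in># eigenvalues (a \<cdot>\<^sub>m A + c \<cdot>\<^sub>m 1\<^sub>m n)"
  shows "(\<mu> - c) / a \<in># eigenvalues A"
proof -
  let ?B = "a \<cdot>\<^sub>m A + c \<cdot>\<^sub>m 1\<^sub>m n"
  have B: "?B \<in> carrier_mat n n" using A by simp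
  obtain v where v: "v \<in> carrier_vec n" "v \<noteq> 0\<^sub>v n" "?B *\<^sub>v v = \<mu> \<cdot>\<^sub>v v"
    using ev B by (auto simp: in_eigenvalues_iff[OF B] eigenvalue_def eigenvector_def)
  have "A *\<^sub>v v = ((\<mu> - c) / a) \<cdot>\<^sub>v v"
  proof (rule eq_vecI)
    fix i assume "i < dim_vec (((\<mu> - c) / a) \<cdot>\<^sub>v v)"
    then have i: "i < n" using v by simp
    have "\<mu> * v $ i = (?B *\<^sub>v v) $ i" using v i by simp
    also have "?B *\<^sub>v v = a \<cdot>\<^sub>v (A *\<^sub>v v) + c \<cdot>\<^sub>v v"
      using v(1) by (rule affine_mult_mat_vec[OF A])
    also have "\<dots> $ i = a * (A *\<^sub>v v) $ i + c * v $ i" using A v i by simp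
    finally show "(A *\<^sub>v v) $ i = (((\<mu> - c) / a) \<cdot>\<^sub>v v) $ i"
      using v i a by (simp add: field_simps)
  qed (use A v in auto)
  then have "eigenvalue A ((\<mu> - c) / a)"
    using v A unfolding eigenvalue_def eigenvector_def by auto
  then show ?thesis by (simp add: in_eigenvalues_iff[OF A])
qed

context
  fixes R :: "real mat" and n :: nat
  assumes R: "R \<in> carrier_mat n n" and sym: "R\<^sup>T = R"
begin

lemma symmetric_eigenvalue_real:
  assumes "\<mu> \<in># eigenvalues (complex_mat R)"
  shows "Im \<mu> = 0"
proof -
  let ?A = "complex_mat R"
  have A: "?A \<in> carrier_mat n n" using R by simp
  obtain v where v: "v \<in> carrier_vec n" "v \<noteq> 0\<^sub>v n" "?A *\<^sub>v v = \<mu> \<cdot>\<^sub>v v"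
    using assms R by (auto simp: in_eigenvalues_iff[OF A] eigenvalue_def eigenvector_def)
  have symR: "R $$ (i, j) = R $$ (j, i)" if "i < n" "j < n" for i j
    using sym that R by (metis carrier_matD index_transpose_mat(1))
  have row: "(\<Sum>j<n. of_real (R $$ (i, j)) * v $ j) = \<mu> * v $ i" if "i < n" for i
    using arg_cong[OF v(3), of "\<lambda>w. w $ i"] that v(1) R
    by (simp add: index_mult_mat_vec_sum[OF A v(1)] del: index_mult_mat_vec)
  \<comment> \<open>s is the Hermitian form of R at v. The eigenvalue equation makes it \<mu> times
    the squared norm of v, and symmetry of R makes it its own conjugate.\<close>
  define s where "s = (\<Sum>i<n. \<Sum>j<n. cnj (v $ i) * (of_real (R $$ (i, j)) * v $ j))"
  define N where "N = (\<Sum>i<n. (cmod (v $ i))\<^sup>2)"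
  have "s = (\<Sum>i<n. cnj (v $ i) * (\<mu> * v $ i))"
    unfolding s_def by (intro sum.cong) (auto simp flip: sum_distrib_left simp: row)
  also have "\<dots> = \<mu> * of_real N"
    unfolding N_def by (simp add: sum_distrib_left complex_norm_square mult_ac del: of_real_power)
  finally have s: "s = \<mu> * of_real N" .
  have "cnj s = (\<Sum>i<n. \<Sum>j<n. v $ i * (of_real (R $$ (i, j)) * cnj (v $ j)))"
    by (simp add: s_def)
  also have "\<dots> = (\<Sum>j<n. \<Sum>i<n. v $ i * (of_real (R $$ (i, j)) * cnj (v $ j)))"
    by (rule sum.swap)
  also have "\<dots> = s"
    unfolding s_def by (intro sum.cong) (auto simp: symR mult_ac)
  finally have "Im s = 0" by (simp add: complex_eq_iff)
  moreover have "N \<noteq> 0"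
  proof
    assume "N = 0"
    then have "\<forall>i<n. v $ i = 0" unfolding N_def by (subst (asm) sum_nonneg_eq_0_iff) auto
    then have "v = 0\<^sub>v n" using v(1) by (intro eq_vecI) auto
    then show False using v by simp
  qed
  ultimately show ?thesis by (simp add: s)
qed

text \<open>A bound on moduli becomes one-sided once the spectrum has been shifted to the
  nonnegative axis: for large c the eigenvalues of a R + c I lie in [0, b + c]. Taking a = 1 gives
  upper bounds and a = -1 lower bounds for the quadratic form of R.\<close>

lemma rayleigh_affine_le:
  assumes a: "a \<noteq> 0" and x: "x \<in> carrier_vec n"
    and b: "\<And>\<mu>. complex_of_real \<mu> \<in># eigenvalues (complex_mat R) \<Longrightarrow> a * \<mu> \<le> b"
  shows "a * (x \<bullet> (R *\<^sub>v x)) \<le> b * (x \<bullet> x)"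
proof -
  \<comment> \<open>The sum dominates \<open>\<bar>a\<bar> * cmod \<mu>\<close> for every
    eigenvalue, and the summand \<open>1 + \<bar>b\<bar>\<close> makes \<open>b + c\<close>
    positive.\<close>
  define c where "c = 1 + \<bar>b\<bar> + (\<Sum>\<mu>\<in>set_mset (eigenvalues (complex_mat R)). \<bar>a\<bar> * cmod \<mu>)"
  have le_c: "\<bar>a\<bar> * cmod \<mu> \<le> c" "b + c > 0" if "\<mu> \<in># eigenvalues (complex_mat R)" for \<mu>
  proof -
    have "\<bar>a\<bar> * cmod \<mu> \<le> (\<Sum>\<mu>\<in>set_mset (eigenvalues (complex_mat R)). \<bar>a\<bar> * cmod \<mu>)"
      using that by (intro member_le_sum) auto
    moreover have "\<bar>a\<bar> * cmod \<mu> \<ge> 0" by simp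
    ultimately show "\<bar>a\<bar> * cmod \<mu> \<le> c" "b + c > 0" unfolding c_def by linarith+
  qed
  define M where "M = a \<cdot>\<^sub>m R + c \<cdot>\<^sub>m 1\<^sub>m n"
  have M: "M \<in> carrier_mat n n" using R by (simp add: M_def)
  have symM: "M\<^sup>T = M"
  proof (rule eq_matI)
    fix i j assume "i < dim_row M" "j < dim_col M"
    then have ij: "i < n" "j < n" using M by auto
    then have "R $$ (j, i) = R $$ (i, j)"
      using sym R by (metis carrier_matD index_transpose_mat(1))
    then show "M\<^sup>T $$ (i, j) = M $$ (i, j)" using ij R by (simp add: M_def)
  qed (use M in auto)
  have cM: "complex_mat M = of_real a \<cdot>\<^sub>m complex_mat R + of_real c \<cdot>\<^sub>m 1\<^sub>m n"
    using R by (intro eq_matI) (auto simp: M_def)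
  have cR: "complex_mat R \<in> carrier_mat n n" using R by simp
  have evM: "cmod \<mu> \<le> b + c \<and> b + c > 0" if "\<mu> \<in># eigenvalues (complex_mat M)" for \<mu>
  proof -
    define \<nu> where "\<nu> = (\<mu> - of_real c) / of_real a"
    have \<nu>: "\<nu> \<in># eigenvalues (complex_mat R)"
      using eigenvalue_affine[OF cR _ that[unfolded cM]] a by (simp add: \<nu>_def)
    then have re: "\<nu> = of_real (Re \<nu>)"
      using symmetric_eigenvalue_real by (simp add: complex_eq_iff)
    have "\<mu> = of_real a * \<nu> + of_real c" using a by (simp add: \<nu>_def)
    then have \<mu>: "\<mu> = of_real (a * Re \<nu> + c)" using re by (metis of_real_add of_real_mult)
    have "a * Re \<nu> \<le> b" using b[of "Re \<nu>"] \<nu> re by simp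
    moreover have "\<bar>a * Re \<nu>\<bar> \<le> c"
      using le_c(1)[OF \<nu>] re by (metis abs_mult norm_of_real)
    ultimately have "\<bar>a * Re \<nu> + c\<bar> \<le> b + c" by linarith
    then show ?thesis using \<mu> le_c(2)[OF \<nu>] by (metis norm_of_real)
  qed
  show ?thesis
  proof (cases "n = 0")
    case True
    then show ?thesis using x R by (auto simp: scalar_prod_def)
  next
    case False
    then have "eigenvalues (complex_mat M) \<noteq> {#}"
      using length_eigenvalue_list[of "complex_mat M" n] M
      by (metis carrier_matD(1) length_0_conv map_carrier_mat mset.simps(1) mset_eigenvalue_list mset_zero_iff)
    then have bc: "b + c > 0" using evM by (meson multiset_nonemptyE)
    have "x \<bullet> (M *\<^sub>v x) \<le> (b + c) * (x \<bullet> x)"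
      using rayleigh_le_spectral_bound[OF M symM x bc] evM by force
    moreover have "M *\<^sub>v x = a \<cdot>\<^sub>v (R *\<^sub>v x) + c \<cdot>\<^sub>v x"
      unfolding M_def by (rule affine_mult_mat_vec[OF R x])
    then have "x \<bullet> (M *\<^sub>v x) = a * (x \<bullet> (R *\<^sub>v x)) + c * (x \<bullet> x)"
      using R x by (simp add: scalar_prod_add_distrib[of _ n])
    ultimately show ?thesis by (simp add: distrib_right)
  qed
qed

lemma quadratic_form_sum:
  "vec n x \<bullet> (R *\<^sub>v vec n x) = (\<Sum>i<n. \<Sum>j<n. R $$ (i, j) * x i * x j)"
proof -
  have "vec n x \<bullet> (R *\<^sub>v vec n x) = (\<Sum>i<n. x i * (\<Sum>j<n. R $$ (i, j) * x j))"
    using R by (simp add: scalar_prod_def[of "vec n x"] atLeast0LessThan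
        index_mult_mat_vec_sum[OF R] del: index_mult_mat_vec)
  then show ?thesis by (simp add: sum_distrib_left mult_ac)
qed

lemma rayleigh_affine_sum_le:
  fixes x :: "nat \<Rightarrow> real"
  assumes "a \<noteq> 0"
    and "\<And>\<mu>. complex_of_real \<mu> \<in># eigenvalues (complex_mat R) \<Longrightarrow> a * \<mu> \<le> b"
  shows "a * (\<Sum>i<n. \<Sum>j<n. R $$ (i, j) * x i * x j) \<le> b * (\<Sum>i<n. (x i)\<^sup>2)"
  using rayleigh_affine_le[of a "vec n x" b] assms unfolding quadratic_form_sum
  by (simp add: scalar_prod_def atLeast0LessThan power2_eq_square)

end

section \<open>Spectra of graphs\<close>

text \<open>\<open>Re\<close> loses nothing on graphs, since the adjacency matrix is real symmetric.
  The real multiset makes order, absolute values and \<open>Max\<close> available.\<close>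

definition graph_spectrum :: "('a, 'b) pre_digraph \<Rightarrow> real multiset" where
  "graph_spectrum G = image_mset Re (eigenvalues (adjacency_matrix G))"

lemma sum_nth_distinct:
  assumes "distinct vs"
  shows "(\<Sum>i<length vs. f (vs ! i)) = (\<Sum>v\<in>set vs. f v)"
  using sum.reindex_bij_betw[OF bij_betw_nth[OF assms refl refl], of f] by simp

lemma prod_mset_filter_eq_if:
  "(\<Prod>x\<in>#filter_mset P M. f x) = (\<Prod>x\<in>#M. if P x then f x else 1)"
  by (induction M) simp_all

context
  fixes G :: "('a, 'b) pre_digraph"
  assumes G: "graph G"
begin

lemma graph_finite_verts: "finite (verts G)"
proof -
  interpret graph G by (rule G)
  show ?thesis by simp
qed

lemma graph_adj_in_verts: "u \<rightarrow>\<^bsub>G\<^esub> v \<Longrightarrow> u \<in> verts G" "u \<rightarrow>\<^bsub>G\<^esub> v \<Longrightarrow> v \<in> verts G"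
proof -
  interpret graph G by (rule G)
  show "u \<rightarrow>\<^bsub>G\<^esub> v \<Longrightarrow> u \<in> verts G" "u \<rightarrow>\<^bsub>G\<^esub> v \<Longrightarrow> v \<in> verts G" by auto
qed

lemma graph_adj_sym: "u \<rightarrow>\<^bsub>G\<^esub> v \<Longrightarrow> v \<rightarrow>\<^bsub>G\<^esub> u"
proof -
  interpret graph G by (rule G)
  show "u \<rightarrow>\<^bsub>G\<^esub> v \<Longrightarrow> v \<rightarrow>\<^bsub>G\<^esub> u" using sym_arcs by (auto simp: symmetric_def sym_def)
qed

lemma graph_adj_irrefl: "\<not> u \<rightarrow>\<^bsub>G\<^esub> u"
proof -
  interpret graph G by (rule G)
  show "\<not> u \<rightarrow>\<^bsub>G\<^esub> u" using adj_not_same by blast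
qed

lemma finite_adj_pairs: "finite {(u, v). u \<rightarrow>\<^bsub>G\<^esub> v}"
  by (rule finite_subset[of _ "verts G \<times> verts G"]) (auto simp: graph_finite_verts dest: graph_adj_in_verts)

private abbreviation "vs \<equiv> vertex_list G"
private abbreviation "N \<equiv> length vs"
private abbreviation "R \<equiv> mat N N (\<lambda>(i, j). of_bool (vs ! i \<rightarrow>\<^bsub>G\<^esub> vs ! j) :: real)"

private lemma vs: "distinct vs" "set vs = verts G"
  using vertex_list[OF graph_finite_verts] by auto

private lemma R: "R \<in> carrier_mat N N" "R\<^sup>T = R"
  by (auto intro!: eq_matI dest: graph_adj_sym)

private lemma adjacency_matrix_eq: "adjacency_matrix G = complex_mat R"
  by (auto simp: adjacency_matrix_def Let_def intro!: eq_matI)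

private lemma carrier: "adjacency_matrix G \<in> carrier_mat N N"
  by (simp add: adjacency_matrix_def Let_def)

lemma eigenvalues_graph_spectrum:
  "eigenvalues (adjacency_matrix G) = image_mset complex_of_real (graph_spectrum G)"
proof -
  have "image_mset (\<lambda>\<mu>. complex_of_real (Re \<mu>)) (eigenvalues (adjacency_matrix G))
      = image_mset (\<lambda>\<mu>. \<mu>) (eigenvalues (adjacency_matrix G))"
    by (rule image_mset_cong)
      (use symmetric_eigenvalue_real[OF R] adjacency_matrix_eq in \<open>auto simp: complex_eq_iff\<close>)
  then show ?thesis by (simp add: graph_spectrum_def image_mset.compositionality o_def)
qed

lemma of_real_in_eigenvalues_iff:
  "complex_of_real x \<in># eigenvalues (adjacency_matrix G) \<longleftrightarrow> x \<in># graph_spectrum G"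
  unfolding eigenvalues_graph_spectrum by auto

lemma size_graph_spectrum: "size (graph_spectrum G) = card (verts G)"
proof -
  have "size (graph_spectrum G) = length (eigenvalue_list (adjacency_matrix G))"
    unfolding graph_spectrum_def by (metis size_image_mset mset_eigenvalue_list size_mset)
  then show ?thesis
    using length_eigenvalue_list[OF adjacency_matrix_carrier[OF graph_finite_verts]] by simp
qed

lemma energy_graph_spectrum: "energy G = (\<Sum>x\<in>#graph_spectrum G. \<bar>x\<bar>)"
  unfolding energy_def eigenvalues_graph_spectrum by (simp add: image_mset.compositionality o_def)

lemma nullity_graph_spectrum: "nullity G = count (graph_spectrum G) 0"
proof -
  have "count (image_mset complex_of_real M) 0 = count M 0" for M
    by (induction M) auto
  then show ?thesis by (simp add: nullity_def eigenvalues_graph_spectrum)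
qed

lemma largest_eigenvalue_graph_spectrum: "largest_eigenvalue G = Max (set_mset (graph_spectrum G))"
  unfolding largest_eigenvalue_def of_real_in_eigenvalues_iff by simp

text \<open>Exactly \<open>card (verts G) - nullity G\<close> entries of the eigenvalue list are
  nonzero. Their index set \<open>I0\<close> is thus the only one of that size that avoids all
  zeros, and the elementary symmetric sum collapses to a single product.\<close>

lemma Upsilon_graph_spectrum:
  "cmod (Upsilon (card (verts G) - nullity G) (adjacency_matrix G))
    = (\<Prod>x\<in>#filter_mset (\<lambda>x. x \<noteq> 0) (graph_spectrum G). \<bar>x\<bar>)"
proof -
  let ?A = "adjacency_matrix G" and ?n = "card (verts G)"
  define es where "es = eigenvalue_list ?A"
  define I0 where "I0 = {i. i < ?n \<and> es ! i \<noteq> 0}"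
  have A: "?A \<in> carrier_mat ?n ?n" by (rule adjacency_matrix_carrier[OF graph_finite_verts])
  have len: "length es = ?n" unfolding es_def by (rule length_eigenvalue_list[OF A])
  have mset_es: "mset es = eigenvalues ?A" by (simp add: es_def mset_eigenvalue_list)
  have I0: "finite I0" "I0 \<subseteq> {..<?n}" by (auto simp: I0_def)
  have "nullity G = length (filter (\<lambda>x. x = 0) es)"
    unfolding nullity_def mset_es[symmetric] count_mset by (simp add: count_list_eq_length_filter) (metis (lifting))
  moreover have "length (filter (\<lambda>x. x \<noteq> 0) es) + length (filter (\<lambda>x. x = 0) es) = ?n"
    using sum_length_filter_compl[of "\<lambda>x. x \<noteq> 0" es] len by simp
  moreover have "length (filter (\<lambda>x. x \<noteq> 0) es) = card I0"
    by (simp add: length_filter_conv_card I0_def len)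
  ultimately have card_I0: "card I0 = ?n - nullity G" by simp
  have "Upsilon (?n - nullity G) ?A
      = (\<Sum>I | I \<subseteq> {..<?n} \<and> card I = card I0. \<Prod>i\<in>I. es ! i)"
    unfolding Upsilon_def card_I0 es_def using A by simp
  also have "\<dots> = (\<Sum>I\<in>{I0}. \<Prod>i\<in>I. es ! i)"
  proof (rule sum.mono_neutral_right)
    show "\<forall>I\<in>{I. I \<subseteq> {..<?n} \<and> card I = card I0} - {I0}. (\<Prod>i\<in>I. es ! i) = 0"
    proof
      fix I assume I: "I \<in> {I. I \<subseteq> {..<?n} \<and> card I = card I0} - {I0}"
      then have fin: "finite I" by (auto intro: finite_subset)
      have "\<not> I \<subseteq> I0" using I card_subset_eq[OF I0(1)] by auto
      then obtain i where "i \<in> I" "i \<notin> I0" by blast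
      then have "es ! i = 0" using I by (auto simp: I0_def)
      then show "(\<Prod>i\<in>I. es ! i) = 0" using fin \<open>i \<in> I\<close> by auto
    qed
  qed (use I0 in auto)
  also have "\<dots> = (\<Prod>i\<in>I0. es ! i)" by simp
  finally have "cmod (Upsilon (?n - nullity G) ?A) = (\<Prod>i\<in>I0. cmod (es ! i))"
    by (simp add: prod_norm)
  also have "\<dots> = (\<Prod>i<?n. if es ! i \<noteq> 0 then cmod (es ! i) else 1)"
    unfolding I0_def using prod.inter_filter[of "{..<?n}" "\<lambda>i. cmod (es ! i)" "\<lambda>i. es ! i \<noteq> 0"] by simp
  also have "\<dots> = (\<Prod>x\<in>#mset es. if x \<noteq> 0 then cmod x else 1)"
    by (simp flip: mset_map add: prod_mset_prod_list prod.list_conv_set_nth len atLeast0LessThan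
        cong: if_cong)
  also have "\<dots> = (\<Prod>x\<in>#graph_spectrum G. if x \<noteq> 0 then \<bar>x\<bar> else 1)"
    unfolding mset_es eigenvalues_graph_spectrum
    by (simp add: image_mset.compositionality o_def cong: if_cong)
  also have "\<dots> = (\<Prod>x\<in>#filter_mset (\<lambda>x. x \<noteq> 0) (graph_spectrum G). \<bar>x\<bar>)"
    by (rule prod_mset_filter_eq_if[symmetric])
  finally show ?thesis .
qed

text \<open>Test vectors are weights on vertices here, free of the chosen enumeration. Ordered pairs
  count each edge twice, exactly as the matrix form does.\<close>

lemma rayleigh_graph:
  fixes x :: "'a \<Rightarrow> real"
  assumes "a \<noteq> 0" and b: "\<And>\<mu>. \<mu> \<in># graph_spectrum G \<Longrightarrow> a * \<mu> \<le> b"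
  shows "a * (\<Sum>(u, v) | u \<rightarrow>\<^bsub>G\<^esub> v. x u * x v) \<le> b * (\<Sum>v\<in>verts G. (x v)\<^sup>2)"
proof -
  have "(\<Sum>i<N. \<Sum>j<N. R $$ (i, j) * x (vs ! i) * x (vs ! j))
      = (\<Sum>i<N. \<Sum>j<N. of_bool (vs ! i \<rightarrow>\<^bsub>G\<^esub> vs ! j) * x (vs ! i) * x (vs ! j))" by simp
  also have "\<dots> = (\<Sum>u\<in>verts G. \<Sum>v\<in>verts G. of_bool (u \<rightarrow>\<^bsub>G\<^esub> v) * x u * x v)"
    using vs by (simp add: sum_nth_distinct[of vs "\<lambda>u. \<Sum>v\<in>verts G. of_bool (u \<rightarrow>\<^bsub>G\<^esub> v) * x u * x v"]
        sum_nth_distinct[of vs "\<lambda>v. of_bool (u \<rightarrow>\<^bsub>G\<^esub> v) * x u * x v" for u])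
  also have "\<dots> = (\<Sum>(u, v)\<in>verts G \<times> verts G. of_bool (u \<rightarrow>\<^bsub>G\<^esub> v) * x u * x v)"
    by (rule sum.cartesian_product)
  also have "\<dots> = (\<Sum>(u, v) | u \<rightarrow>\<^bsub>G\<^esub> v. x u * x v)"
    by (rule sum.mono_neutral_cong_right) (auto simp: graph_finite_verts dest: graph_adj_in_verts)
  finally have form: "(\<Sum>i<N. \<Sum>j<N. R $$ (i, j) * x (vs ! i) * x (vs ! j)) = \<dots>" .
  have "(\<Sum>i<N. (x (vs ! i))\<^sup>2) = (\<Sum>v\<in>verts G. (x v)\<^sup>2)"
    using sum_nth_distinct[OF vs(1), of "\<lambda>v. (x v)\<^sup>2"] vs(2) by simp
  with rayleigh_affine_sum_le[OF R assms(1), of b "\<lambda>i. x (vs ! i)"] form show ?thesis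
    using b by (simp add: of_real_in_eigenvalues_iff flip: adjacency_matrix_eq)
qed

text \<open>Carries an eigenvector from matrix indices over to vertices, so that the eigenvalue
  equation speaks about sums over neighbours.\<close>

lemma graph_spectrum_eigenvector:
  assumes "\<mu> \<in># graph_spectrum G"
  obtains f :: "'a \<Rightarrow> complex" and w where "w \<in> verts G" "f w \<noteq> 0"
    "\<And>u. u \<in> verts G \<Longrightarrow> (\<Sum>v | u \<rightarrow>\<^bsub>G\<^esub> v. f v) = of_real \<mu> * f u"
proof -
  have "eigenvalue (adjacency_matrix G) (of_real \<mu>)"
    using assms by (simp add: of_real_in_eigenvalues_iff flip: in_eigenvalues_iff[OF carrier])
  then obtain y where y: "y \<in> carrier_vec N" "y \<noteq> 0\<^sub>v N"
      "adjacency_matrix G *\<^sub>v y = of_real \<mu> \<cdot>\<^sub>v y"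
    using carrier by (auto simp: eigenvalue_def eigenvector_def)
  define idx where "idx = the_inv_into {..<N} (\<lambda>i. vs ! i)"
  have bij: "bij_betw (\<lambda>i. vs ! i) {..<N} (verts G)"
    using bij_betw_nth[OF vs(1) refl] vs(2) by simp
  have idx: "idx (vs ! i) = i" if "i < N" for i
    unfolding idx_def using bij that by (intro the_inv_into_f_f) (auto simp: bij_betw_def)
  define f where "f v = y $ idx v" for v
  obtain i where i: "i < N" "y $ i \<noteq> 0"
    using y by (metis carrier_vecD eq_vecI index_zero_vec)
  have "(\<Sum>v | u \<rightarrow>\<^bsub>G\<^esub> v. f v) = of_real \<mu> * f u" if u: "u \<in> verts G" for u
  proof -
    obtain k where k: "k < N" "u = vs ! k" using bij u unfolding bij_betw_def by blast
    have "of_real \<mu> * f u = (adjacency_matrix G *\<^sub>v y) $ k" using k y idx by (simp add: f_def)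
    also have "\<dots> = (\<Sum>l<N. of_bool (vs ! k \<rightarrow>\<^bsub>G\<^esub> vs ! l) * f (vs ! l))"
      unfolding index_mult_mat_vec_sum[OF carrier y(1) k(1)]
      using k by (intro sum.cong) (auto simp: adjacency_matrix_def Let_def f_def idx)
    also have "\<dots> = (\<Sum>v\<in>verts G. of_bool (u \<rightarrow>\<^bsub>G\<^esub> v) * f v)"
      using sum_nth_distinct[OF vs(1), of "\<lambda>v. of_bool (u \<rightarrow>\<^bsub>G\<^esub> v) * f v"] vs(2) k by simp
    also have "\<dots> = (\<Sum>v | u \<rightarrow>\<^bsub>G\<^esub> v. f v)"
      by (rule sum.mono_neutral_cong_right) (auto simp: graph_finite_verts dest: graph_adj_in_verts)
    finally show ?thesis by simp
  qed
  then show ?thesis using i idx bij by (intro that[of "vs ! i" f]) (auto simp: f_def bij_betw_def)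
qed

private lemma sum_spectrum_pow: "(\<Sum>x\<in>#graph_spectrum G. x ^ k) = mat_trace (R ^\<^sub>m k)"
proof -
  have "complex_of_real (\<Sum>x\<in>#graph_spectrum G. x ^ k) = (\<Sum>\<mu>\<in>#eigenvalues (adjacency_matrix G). \<mu> ^ k)"
    unfolding eigenvalues_graph_spectrum
    by (simp add: image_mset.compositionality o_def of_real_hom.hom_sum_mset)
  also have "\<dots> = mat_trace (adjacency_matrix G ^\<^sub>m k)"
    by (rule trace_pow_eigenvalues[OF carrier, symmetric])
  also have "\<dots> = complex_of_real (mat_trace (R ^\<^sub>m k))"
    unfolding adjacency_matrix_eq using R pow_carrier_mat[OF R(1), of k]
    by (simp flip: of_real_hom.mat_hom_pow[OF R(1)])
  finally show ?thesis by (simp only: of_real_eq_iff)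
qed

lemma sum_graph_spectrum: "(\<Sum>x\<in>#graph_spectrum G. x) = 0"
  using sum_spectrum_pow[of 1] by (simp add: graph_adj_irrefl)

text \<open>A closed walk of length two follows an edge and returns, so the trace of the square
  counts ordered adjacent pairs.\<close>

lemma sum_graph_spectrum_2: "(\<Sum>x\<in>#graph_spectrum G. x\<^sup>2) = card {(u, v). u \<rightarrow>\<^bsub>G\<^esub> v}"
proof -
  have "(\<Sum>x\<in>#graph_spectrum G. x\<^sup>2) = mat_trace (R * R)"
    unfolding sum_spectrum_pow by (simp add: numeral_2_eq_2)
  also have "\<dots> = (\<Sum>i<N. \<Sum>j<N. of_bool (vs ! i \<rightarrow>\<^bsub>G\<^esub> vs ! j))"
    by (auto simp: index_mult_mat_sum[OF R(1) R(1)] simp del: index_mult_mat(1) sum_of_bool_eq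
        sum_of_bool_mult_eq sum_mult_of_bool_eq intro!: sum.cong dest: graph_adj_sym)
  also have "\<dots> = (\<Sum>u\<in>verts G. \<Sum>v\<in>verts G. of_bool (u \<rightarrow>\<^bsub>G\<^esub> v))"
    using vs by (simp add: sum_nth_distinct[of vs "\<lambda>u. \<Sum>v\<in>verts G. of_bool (u \<rightarrow>\<^bsub>G\<^esub> v)"]
        sum_nth_distinct[of vs "\<lambda>v. of_bool (u \<rightarrow>\<^bsub>G\<^esub> v)" for u] del: sum_of_bool_eq)
  also have "\<dots> = (\<Sum>(u, v)\<in>verts G \<times> verts G. of_bool (u \<rightarrow>\<^bsub>G\<^esub> v))"
    by (rule sum.cartesian_product)
  also have "\<dots> = (\<Sum>(u, v) | u \<rightarrow>\<^bsub>G\<^esub> v. 1)"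
    by (rule sum.mono_neutral_cong_right) (auto simp: graph_finite_verts dest: graph_adj_in_verts)
  finally show ?thesis by simp
qed

text \<open>Closed walks of length three are triangles with a chosen start and direction.\<close>

lemma sum_graph_spectrum_3:
  "(\<Sum>x\<in>#graph_spectrum G. x ^ 3) = card {(u, v, w). u \<rightarrow>\<^bsub>G\<^esub> v \<and> v \<rightarrow>\<^bsub>G\<^esub> w \<and> w \<rightarrow>\<^bsub>G\<^esub> u}"
proof -
  define h where "h u v w = (of_bool (u \<rightarrow>\<^bsub>G\<^esub> v \<and> v \<rightarrow>\<^bsub>G\<^esub> w \<and> w \<rightarrow>\<^bsub>G\<^esub> u) :: real)" for u v w
  have RR: "R * R \<in> carrier_mat N N" by (rule mult_carrier_mat[OF R(1) R(1)])
  have "(\<Sum>x\<in>#graph_spectrum G. x ^ 3) = mat_trace (R * R * R)"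
    unfolding sum_spectrum_pow by (simp add: numeral_3_eq_3)
  also have "\<dots> = (\<Sum>i<N. \<Sum>k<N. \<Sum>j<N. h (vs ! i) (vs ! j) (vs ! k))"
    by (simp add: index_mult_mat_sum[OF RR R(1)] index_mult_mat_sum[OF R(1) R(1)] sum_distrib_right
        h_def of_bool_conj mult.assoc del: index_mult_mat(1) sum_of_bool_eq sum_of_bool_mult_eq
        sum_mult_of_bool_eq)
  also have "\<dots> = (\<Sum>i<N. \<Sum>j<N. \<Sum>k<N. h (vs ! i) (vs ! j) (vs ! k))"
    by (intro sum.cong refl sum.swap)
  also have "\<dots> = (\<Sum>u\<in>verts G. \<Sum>v\<in>verts G. \<Sum>w\<in>verts G. h u v w)"
    using vs by (simp add: sum_nth_distinct[of vs "\<lambda>u. \<Sum>v\<in>verts G. \<Sum>w\<in>verts G. h u v w"]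
        sum_nth_distinct[of vs "\<lambda>v. \<Sum>w\<in>verts G. h u v w" for u] sum_nth_distinct[of vs "h u v" for u v])
  also have "\<dots> = (\<Sum>(u, v, w)\<in>verts G \<times> verts G \<times> verts G. h u v w)"
    by (simp add: sum.cartesian_product)
  also have "\<dots> = (\<Sum>(u, v, w) | u \<rightarrow>\<^bsub>G\<^esub> v \<and> v \<rightarrow>\<^bsub>G\<^esub> w \<and> w \<rightarrow>\<^bsub>G\<^esub> u. 1)"
    by (rule sum.mono_neutral_cong_right)
      (auto simp: graph_finite_verts h_def dest: graph_adj_in_verts)
  finally show ?thesis by simp
qed

end

section \<open>Isomorphisms\<close>

lemma adj_iff_ends: "u \<rightarrow>\<^bsub>G\<^esub> v \<longleftrightarrow> (\<exists>e\<in>arcs G. tail G e = u \<and> head G e = v)"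
  by (auto simp: arcs_ends_conv)

lemma graph_nomulti: "graph G \<Longrightarrow> nomulti_digraph G"
proof -
  assume "graph G"
  then interpret graph G .
  show ?thesis by unfold_locales
qed

lemma nomulti_disjoint_union:
  assumes "nomulti_digraph G" "nomulti_digraph H"
  shows "nomulti_digraph (G \<uplus>\<^sub>G H)"
proof -
  interpret G: nomulti_digraph G by fact
  interpret H: nomulti_digraph H by fact
  show ?thesis
    by unfold_locales
      (auto simp: disjoint_union_def arc_to_ends_def intro: G.no_multi_arcs H.no_multi_arcs)
qed

lemma nomulti_copies:
  assumes "nomulti_digraph H"
  shows "nomulti_digraph (copies t H)"
proof -
  interpret H: nomulti_digraph H by fact
  show ?thesis
    by unfold_locales
      (auto simp: copies_def arc_to_ends_def intro: H.no_multi_arcs)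
qed

lemma adj_disjoint_union:
  "Inl u \<rightarrow>\<^bsub>G \<uplus>\<^sub>G H\<^esub> Inl v \<longleftrightarrow> u \<rightarrow>\<^bsub>G\<^esub> v"
  "Inr x \<rightarrow>\<^bsub>G \<uplus>\<^sub>G H\<^esub> Inr y \<longleftrightarrow> x \<rightarrow>\<^bsub>H\<^esub> y"
  "\<not> Inl u \<rightarrow>\<^bsub>G \<uplus>\<^sub>G H\<^esub> Inr y"
  "\<not> Inr x \<rightarrow>\<^bsub>G \<uplus>\<^sub>G H\<^esub> Inl v"
  unfolding adj_iff_ends by (force simp: disjoint_union_def)+

lemma adj_copies:
  "(i, u) \<rightarrow>\<^bsub>copies t H\<^esub> (j, v) \<longleftrightarrow> i < t \<and> j = i \<and> u \<rightarrow>\<^bsub>H\<^esub> v"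
  unfolding adj_iff_ends by (force simp: copies_def)

lemma adj_complete_graph: "u \<rightarrow>\<^bsub>complete_graph s\<^esub> v \<longleftrightarrow> u < s \<and> v < s \<and> u \<noteq> v"
  unfolding adj_iff_ends by (auto simp: complete_graph_def)

lemma verts_constructions:
  "verts (G \<uplus>\<^sub>G H) = verts G <+> verts H"
  "verts (copies t G) = {..<t} \<times> verts G"
  "verts (complete_graph s) = {..<s}"
  by (simp_all add: disjoint_union_def copies_def complete_graph_def)

lemma digraph_isomorphism_adj_iff:
  assumes f: "pre_digraph.digraph_isomorphism G f" and uv: "u \<in> verts G" "v \<in> verts G"
  shows "iso_verts f u \<rightarrow>\<^bsub>app_iso f G\<^esub> iso_verts f v \<longleftrightarrow> u \<rightarrow>\<^bsub>G\<^esub> v"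
proof -
  interpret wf_digraph G using f by (simp add: pre_digraph.digraph_isomorphism_def)
  have "iso_tail f (iso_arcs f e) = iso_verts f u \<longleftrightarrow> tail G e = u"
       "iso_head f (iso_arcs f e) = iso_verts f v \<longleftrightarrow> head G e = v" if "e \<in> arcs G" for e
    using f uv that by (simp_all add: iso_verts_tail iso_verts_head)
  then show ?thesis unfolding adj_iff_ends by auto
qed

text \<open>
  Without multiple arcs, a vertex bijection preserving adjacency determines the arc map; the
  tail and head functions of the target are carried by the isomorphism record itself.
\<close>
lemma vertex_bijection_digraph_isomorphism:
  assumes G: "nomulti_digraph G" and H: "nomulti_digraph H"
    and h: "bij_betw h (verts G) (verts H)"
    and adj: "\<And>u v. u \<in> verts G \<Longrightarrow> v \<in> verts G \<Longrightarrow> u \<rightarrow>\<^bsub>G\<^esub> v \<longleftrightarrow> h u \<rightarrow>\<^bsub>H\<^esub> h v"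
  obtains f where "pre_digraph.digraph_isomorphism G f" "app_iso f G = H" "iso_verts f = h"
proof -
  interpret G: nomulti_digraph G by fact
  interpret H: nomulti_digraph H by fact
  have inj: "inj_on h (verts G)" and surj: "h ` verts G = verts H"
    using h by (auto simp: bij_betw_def)
  define k where "k e = (SOME e'. e' \<in> arcs H \<and> tail H e' = h (tail G e) \<and> head H e' = h (head G e))" for e
  have k: "k e \<in> arcs H \<and> tail H (k e) = h (tail G e) \<and> head H (k e) = h (head G e)"
    if e: "e \<in> arcs G" for e
  proof -
    have "h (tail G e) \<rightarrow>\<^bsub>H\<^esub> h (head G e)"
      using adj[of "tail G e" "head G e"] e by (auto simp: adj_iff_ends)
    then have "\<exists>e'. e' \<in> arcs H \<and> tail H e' = h (tail G e) \<and> head H e' = h (head G e)"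
      unfolding adj_iff_ends by blast
    then show ?thesis unfolding k_def by (rule someI_ex)
  qed
  \<comment> \<open>Injectivity of the arc map rests on the absence of parallel arcs in G,
    surjectivity on their absence in H.\<close>
  have "inj_on k (arcs G)"
  proof (rule inj_onI)
    fix e e' assume e: "e \<in> arcs G" "e' \<in> arcs G" "k e = k e'"
    then have "h (tail G e) = h (tail G e')" "h (head G e) = h (head G e')"
      using k by metis+
    then have "arc_to_ends G e = arc_to_ends G e'"
      using inj e by (auto simp: arc_to_ends_def inj_on_def)
    then show "e = e'" using e G.no_multi_arcs by blast
  qed
  moreover have "k ` arcs G = arcs H"
  proof
    show "arcs H \<subseteq> k ` arcs G"
    proof
      fix e' assume e': "e' \<in> arcs H"
      then have "tail H e' \<in> h ` verts G" "head H e' \<in> h ` verts G" using surj by auto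
      then obtain u v where uv: "u \<in> verts G" "v \<in> verts G" "tail H e' = h u" "head H e' = h v"
        by blast
      then have "u \<rightarrow>\<^bsub>G\<^esub> v" using adj[of u v] e' by (auto simp: adj_iff_ends)
      then obtain e where e: "e \<in> arcs G" "tail G e = u" "head G e = v"
        by (auto simp: adj_iff_ends)
      then have "k e = e'"
        using k[OF e(1)] e' uv by (intro H.no_multi_arcs) (auto simp: arc_to_ends_def)
      then show "e' \<in> k ` arcs G" using e by blast
    qed
  qed (use k in auto)
  ultimately show ?thesis
    using k inj surj
    by (intro that[of "\<lparr>iso_verts = h, iso_arcs = k, iso_head = head H, iso_tail = tail H\<rparr>"])
      (auto simp: pre_digraph.digraph_isomorphism_def app_iso_def G.wf_digraph)
qed

lemma bij_betw_sum:
  assumes f: "bij_betw f A C" and g: "bij_betw g B D" and disj: "A \<inter> B = {}"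
  shows "bij_betw (\<lambda>x. if x \<in> A then Inl (f x) else Inr (g x)) (A \<union> B) (C <+> D)"
proof -
  let ?h = "\<lambda>x. if x \<in> A then Inl (f x) else Inr (g x)"
  have "inj_on ?h (A \<union> B)"
    using f g by (auto simp: bij_betw_def inj_on_def)
  moreover have "?h ` A = Inl ` C" using f by (auto simp: bij_betw_def image_image)
  moreover have "?h ` B = Inr ` D"
    using g disj by (force simp: bij_betw_def)
  ultimately show ?thesis by (auto simp: bij_betw_def image_Un Plus_def)
qed

text \<open>An arbitrary injective numbering \<open>ix\<close> breaks the symmetry within each pair:
  L collects the member with the smaller number. A representative gets label 0, its mate label 1,
  and both share the index of the representative. Evenness falls out because \<open>mate\<close>
  maps L onto the rest of M.\<close>

lemma perfect_matching_bijection: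
  assumes fin: "finite M" and mate: "\<And>v. v \<in> M \<Longrightarrow> mate v \<in> M \<and> mate v \<noteq> v \<and> mate (mate v) = v"
  obtains h :: "'a \<Rightarrow> nat \<times> nat"
  where "even (card M)" "bij_betw h M ({..<card M div 2} \<times> {..<2})"
    "\<And>u v. u \<in> M \<Longrightarrow> v \<in> M \<Longrightarrow> v = mate u \<longleftrightarrow> fst (h u) = fst (h v) \<and> snd (h u) \<noteq> snd (h v)"
proof -
  obtain ix :: "'a \<Rightarrow> nat" where ix: "inj_on ix M" using finite_imp_inj_to_nat_seg[OF fin] by blast
  define L where "L = {v \<in> M. ix v < ix (mate v)}"
  have mate_L: "mate v \<in> L" if "v \<in> M - L" for v
    using that mate[of v] ix by (auto simp: L_def inj_on_def not_less le_less)
  have mate_notL: "mate v \<notin> L" if "v \<in> L" for v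
    using that mate[of v] by (auto simp: L_def)
  have fin_L: "finite L" using fin by (simp add: L_def)
  have "mate ` L = M - L"
    using mate mate_L mate_notL by (force simp: L_def intro: rev_image_eqI)
  moreover have "inj_on mate L" using mate by (metis (no_types, lifting) L_def inj_onI mem_Collect_eq)
  ultimately have bm: "bij_betw mate L (M - L)" by (simp add: bij_betw_def)
  then have "card (M - L) = card L" by (simp add: bij_betw_same_card)
  then have card_M: "card M = 2 * card L"
    using card_Diff_subset[of L M] card_mono[of M L] fin fin_L by (auto simp: L_def)
  obtain b where b: "bij_betw b L {..<card L}"
    using ex_bij_betw_finite_nat[OF fin_L] by (auto simp: atLeast0LessThan)
  define h where "h v = (if v \<in> L then (b v, 0) else (b (mate v), 1 :: nat))" for v
  have b_inj: "b u = b v \<longleftrightarrow> u = v" if "u \<in> L" "v \<in> L" for u v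
    using b that by (auto simp: bij_betw_def inj_on_def)
  have "bij_betw h M ({..<card L} \<times> {..<2})"
  proof (rule bij_betwI')
    fix u v assume uv: "u \<in> M" "v \<in> M"
    show "h u = h v \<longleftrightarrow> u = v"
      using uv mate_L mate b_inj by (auto simp: h_def) metis+
  next
    fix v assume "v \<in> M"
    then show "h v \<in> {..<card L} \<times> {..<2}"
      using b mate_L by (auto simp: h_def bij_betw_def)
  next
    fix p :: "nat \<times> nat" assume p: "p \<in> {..<card L} \<times> {..<2}"
    then have "fst p \<in> b ` L" using b by (auto simp: bij_betw_def)
    then obtain v where v: "v \<in> L" "b v = fst p" by force
    show "\<exists>v\<in>M. p = h v"
    proof (cases "snd p = 0")
      case True
      then show ?thesis using v by (intro bexI[of _ v]) (auto simp: h_def L_def prod_eq_iff)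
    next
      case False
      then have "snd p = 1" using p by auto
      then show ?thesis using v mate[of v] mate_notL[of v]
        by (intro bexI[of _ "mate v"]) (auto simp: h_def L_def prod_eq_iff)
    qed
  qed
  moreover have "v = mate u \<longleftrightarrow> fst (h u) = fst (h v) \<and> snd (h u) \<noteq> snd (h v)"
    if "u \<in> M" "v \<in> M" for u v
    using that mate_L mate_notL mate b_inj by (auto simp: h_def)
  ultimately show ?thesis using card_M by (intro that[of h]) auto
qed

section \<open>Components and the energy bound\<close>

text \<open>The map (u, v) to {u, v} has fibres of size exactly two: symmetry supplies the reversed
  pair, and irreflexivity keeps the two distinct.\<close>

lemma card_adj_pairs_edges:
  fixes H :: "('a, 'b) pre_digraph"
  assumes fin: "finite {(u, v). u \<rightarrow>\<^bsub>H\<^esub> v}"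
    and sym: "\<And>u v. u \<rightarrow>\<^bsub>H\<^esub> v \<Longrightarrow> v \<rightarrow>\<^bsub>H\<^esub> u" and irrefl: "\<And>u. \<not> u \<rightarrow>\<^bsub>H\<^esub> u"
  shows "card {(u, v). u \<rightarrow>\<^bsub>H\<^esub> v} = 2 * card (edges H)"
proof -
  let ?E = "{(u, v). u \<rightarrow>\<^bsub>H\<^esub> v}" and ?g = "\<lambda>(u, v). {u, v}"
  have edges: "edges H = ?g ` ?E" by (auto simp: edges_def)
  have two: "card {p \<in> ?E. ?g p = e} = 2" if e: "e \<in> ?g ` ?E" for e
  proof -
    obtain u v where uv: "u \<rightarrow>\<^bsub>H\<^esub> v" "e = {u, v}" using e by auto
    then have "{p \<in> ?E. ?g p = e} = {(u, v), (v, u)}"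
      using sym by (auto simp: doubleton_eq_iff)
    moreover have "u \<noteq> v" using uv irrefl by auto
    ultimately show ?thesis by simp
  qed
  have "card ?E = (\<Sum>e\<in>?g ` ?E. card {p \<in> ?E. ?g p = e})"
    using sum.image_gen[OF fin, of "\<lambda>_. 1::nat" ?g] by simp
  also have "\<dots> = (\<Sum>e\<in>?g ` ?E. 2)" by (rule sum.cong[OF refl two])
  finally show ?thesis by (simp add: edges)
qed

section \<open>Connected components and their average degree\<close>

context
  fixes G G\<^sub>1 :: "('a, 'b) pre_digraph"
  assumes G: "graph G" and G1: "G\<^sub>1 \<in> pre_digraph.sccs G"
begin

private lemma induced: "induced_subgraph G\<^sub>1 G"
  by (rule pre_digraph.in_sccs_imp_induced[OF G1])

lemma component_verts_subset: "verts G\<^sub>1 \<subseteq> verts G"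
  using induced by (auto simp: induced_subgraph_def subgraph_def)

lemma component_nomulti: "nomulti_digraph G\<^sub>1"
proof -
  interpret G: graph G by (rule G)
  interpret G1: wf_digraph G\<^sub>1 using induced by (auto simp: induced_subgraph_def subgraph_def)
  have "arcs G\<^sub>1 \<subseteq> arcs G" "compatible G G\<^sub>1"
    using induced by (auto simp: induced_subgraph_def subgraph_def)
  then show ?thesis
    by unfold_locales (auto simp: compatible_def arc_to_ends_def intro: G.no_multi_arcs)
qed

lemma component_adj_iff:
  "u \<rightarrow>\<^bsub>G\<^sub>1\<^esub> v \<longleftrightarrow> u \<in> verts G\<^sub>1 \<and> v \<in> verts G\<^sub>1 \<and> u \<rightarrow>\<^bsub>G\<^esub> v"
proof -
  have "arcs G\<^sub>1 = {e \<in> arcs G. tail G e \<in> verts G\<^sub>1 \<and> head G e \<in> verts G\<^sub>1}"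
    and c: "tail G\<^sub>1 = tail G" "head G\<^sub>1 = head G"
    using induced by (auto simp: induced_subgraph_def subgraph_def compatible_def)
  then show ?thesis unfolding adj_iff_ends c by auto
qed

text \<open>By symmetry, a neighbour is reachable in both directions and so belongs to the same
  strong component.\<close>

lemma component_closed:
  assumes "u \<in> verts G\<^sub>1" "u \<rightarrow>\<^bsub>G\<^esub> v"
  shows "v \<in> verts G\<^sub>1"
proof -
  interpret G: graph G by (rule G)
  have "verts G\<^sub>1 \<in> G.sccs_verts" using G1 G.in_sccs_vertsI_sccs by blast
  then have "v \<notin> verts G\<^sub>1 \<longrightarrow> \<not> u \<rightarrow>\<^sup>*\<^bsub>G\<^esub> v \<or> \<not> v \<rightarrow>\<^sup>*\<^bsub>G\<^esub> u"
    using assms(1) unfolding G.in_sccs_verts_conv_reachable by blast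
  moreover have "u \<rightarrow>\<^sup>*\<^bsub>G\<^esub> v" "v \<rightarrow>\<^sup>*\<^bsub>G\<^esub> u"
    using assms(2) graph_adj_sym[OF G] by (auto intro: G.reachable_adjI)
  ultimately show ?thesis by blast
qed

text \<open>The form in which connectedness is used: an adjacency-closed set that meets the
  component swallows it.\<close>

lemma component_subset:
  assumes u: "u \<in> verts G\<^sub>1" "u \<in> A"
    and closed: "\<And>x y. x \<in> A \<Longrightarrow> x \<rightarrow>\<^bsub>G\<^esub> y \<Longrightarrow> y \<in> A"
  shows "verts G\<^sub>1 \<subseteq> A"
proof
  fix v assume v: "v \<in> verts G\<^sub>1"
  interpret G1: nomulti_digraph G\<^sub>1 by (rule component_nomulti)
  have "strongly_connected G\<^sub>1" using G1 by (simp add: pre_digraph.sccs_def)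
  then have "u \<rightarrow>\<^sup>*\<^bsub>G\<^sub>1\<^esub> v" using u v by (auto simp: strongly_connected_def)
  then show "v \<in> A"
    by (induction rule: G1.reachable_induct) (use u closed component_adj_iff in blast)+
qed

lemma finite_component: "finite (verts G\<^sub>1)"
  using component_verts_subset graph_finite_verts[OF G] finite_subset by blast

lemma finite_component_adj_pairs: "finite {(u, v). u \<rightarrow>\<^bsub>G\<^sub>1\<^esub> v}"
  by (rule finite_subset[OF _ finite_adj_pairs[OF G]]) (auto simp: component_adj_iff)

lemma card_component_adj_pairs: "card {(u, v). u \<rightarrow>\<^bsub>G\<^sub>1\<^esub> v} = 2 * card (edges G\<^sub>1)"
  by (rule card_adj_pairs_edges[OF finite_component_adj_pairs])
    (auto simp: component_adj_iff graph_adj_irrefl[OF G] dest: graph_adj_sym[OF G])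

text \<open>This is the bound 1 \<le> d. A vertex without neighbours would be a closed set, hence
  the whole component, which has at least two vertices; so every vertex starts an adjacent
  pair.\<close>

lemma card_component_le_edges:
  assumes "card (verts G\<^sub>1) \<ge> 2"
  shows "card (verts G\<^sub>1) \<le> 2 * card (edges G\<^sub>1)"
proof -
  have "verts G\<^sub>1 \<subseteq> fst ` {(u, v). u \<rightarrow>\<^bsub>G\<^sub>1\<^esub> v}"
  proof
    fix u assume u: "u \<in> verts G\<^sub>1"
    have "\<exists>v. u \<rightarrow>\<^bsub>G\<^esub> v"
    proof (rule ccontr)
      assume "\<nexists>v. u \<rightarrow>\<^bsub>G\<^esub> v"
      then have "verts G\<^sub>1 \<subseteq> {u}" using component_subset[OF u, of "{u}"] by blast
      then have "card (verts G\<^sub>1) \<le> card {u}" by (intro card_mono) auto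
      then show False using assms by simp
    qed
    then obtain v where "u \<rightarrow>\<^bsub>G\<^esub> v" by blast
    then have "(u, v) \<in> {(u, v). u \<rightarrow>\<^bsub>G\<^sub>1\<^esub> v}"
      using u component_closed[OF u, of v] by (simp add: component_adj_iff)
    then show "u \<in> fst ` {(u, v). u \<rightarrow>\<^bsub>G\<^sub>1\<^esub> v}" by (metis fst_conv imageI)
  qed
  then show ?thesis
    unfolding card_component_adj_pairs[symmetric] by (rule surj_card_le[OF finite_component_adj_pairs])
qed

text \<open>The test vector is the indicator of the component: its quadratic form is 2
  \<open>m\<^sub>1\<close> and its squared norm is \<open>n\<^sub>1\<close>.\<close>

lemma average_degree_le:
  assumes "\<And>\<mu>. \<mu> \<in># graph_spectrum G \<Longrightarrow> \<mu> \<le> b"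
  shows "2 * real (card (edges G\<^sub>1)) \<le> b * real (card (verts G\<^sub>1))"
proof -
  let ?x = "\<lambda>v. of_bool (v \<in> verts G\<^sub>1) :: real"
  have "(\<Sum>(u, v) | u \<rightarrow>\<^bsub>G\<^esub> v. ?x u * ?x v) = (\<Sum>(u, v) | u \<rightarrow>\<^bsub>G\<^sub>1\<^esub> v. 1)"
    by (rule sum.mono_neutral_cong_right[OF finite_adj_pairs[OF G]]) (auto simp: component_adj_iff)
  also have "\<dots> = 2 * real (card (edges G\<^sub>1))" using card_component_adj_pairs by simp
  finally have "2 * real (card (edges G\<^sub>1)) \<le> b * (\<Sum>v\<in>verts G. (?x v)\<^sup>2)"
    using rayleigh_graph[OF G, of 1 b ?x] assms by simp
  also have "(\<Sum>v\<in>verts G. (?x v)\<^sup>2) = (\<Sum>v\<in>verts G\<^sub>1. 1)"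
    by (rule sum.mono_neutral_cong_right) (use component_verts_subset graph_finite_verts[OF G] in auto)
  finally show ?thesis by simp
qed

lemma regular_component_edges:
  assumes "regular_graph r G\<^sub>1"
  shows "2 * card (edges G\<^sub>1) = card (verts G\<^sub>1) * r"
proof -
  interpret G1: nomulti_digraph G\<^sub>1 by (rule component_nomulti)
  have ends: "{(u, v). u \<rightarrow>\<^bsub>G\<^sub>1\<^esub> v} = arc_to_ends G\<^sub>1 ` arcs G\<^sub>1" by (auto simp: arcs_ends_def)
  then have fin: "finite (arcs G\<^sub>1)"
    using finite_component_adj_pairs G1.inj_on_arc_to_ends finite_imageD by metis
  have "card {(u, v). u \<rightarrow>\<^bsub>G\<^sub>1\<^esub> v} = card (arcs G\<^sub>1)"
    unfolding ends by (rule card_image[OF G1.inj_on_arc_to_ends])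
  also have "\<dots> = (\<Sum>v\<in>verts G\<^sub>1. card {e \<in> arcs G\<^sub>1. tail G\<^sub>1 e = v})"
    using sum.group[OF fin finite_component, of "tail G\<^sub>1" "\<lambda>_. 1::nat"] G1.tail_in_verts
    by (simp add: image_subset_iff)
  also have "\<dots> = (\<Sum>v\<in>verts G\<^sub>1. r)"
    using assms by (intro sum.cong) (auto simp: regular_graph_def out_degree_def out_arcs_def)
  finally show ?thesis using card_component_adj_pairs by simp
qed

end

text \<open>The excess of \<bar>x\<bar> over the contribution 1 + ln \<bar>x\<bar> of one nonzero
  eigenvalue to the bound. Zero eigenvalues get 0, since they enter neither n - \<kappa> nor the
  product behind \<open>Upsilon\<close>.\<close>

definition energy_gap :: "real \<Rightarrow> real" where
  "energy_gap x = (if x = 0 then 0 else \<bar>x\<bar> - 1 - ln \<bar>x\<bar>)"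

lemma energy_gap_nonneg: "energy_gap x \<ge> 0"
  using ln_le_minus_one[of "\<bar>x\<bar>"] by (auto simp: energy_gap_def)

lemma energy_gap_eq_0_iff: "energy_gap x = 0 \<longleftrightarrow> x \<in> {-1, 0, 1}"
  using ln_eq_minus_one[of "\<bar>x\<bar>"] by (auto simp: energy_gap_def)

lemma sum_abs_energy_gap:
  "(\<Sum>x\<in>#M. \<bar>x\<bar>) = real (size (filter_mset (\<lambda>x. x \<noteq> 0) M))
    + ln (\<Prod>x\<in>#filter_mset (\<lambda>x. x \<noteq> 0) M. \<bar>x\<bar>) + (\<Sum>x\<in>#M. energy_gap x)"
proof (induction M)
  case (add x M)
  have "(\<Prod>x\<in>#filter_mset (\<lambda>x. x \<noteq> 0) M. \<bar>x\<bar>) > 0" for M :: "real multiset"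
    by (induction M) auto
  then show ?case using add by (auto simp: energy_gap_def ln_mult)
qed simp

lemma size_filter_nonzero: "size (filter_mset (\<lambda>x. x \<noteq> 0) M) + count M 0 = size M"
  by (induction M) auto

text \<open>Apply ln t \<le> t - 1 at t = x / d and use x / d - 1 = (x - d) / d \<le> x - d, valid
  for d \<ge> 1. The equality case of the logarithmic inequality gives strictness.\<close>

lemma diff_ln_mono:
  fixes d x :: real
  assumes "1 \<le> d" "d \<le> x"
  shows "d - ln d \<le> x - ln x" "d - ln d = x - ln x \<Longrightarrow> d = x"
proof -
  have ln: "ln x - ln d = ln (x / d)" using assms by (simp add: ln_div)
  have le: "x / d - 1 \<le> x - d"
  proof -
    have "(x - d) / d \<le> x - d" using assms mult_left_mono[of 1 d "x - d"] by (simp add: field_simps)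
    then show ?thesis using assms by (simp add: diff_divide_distrib)
  qed
  have pos: "x / d > 0" using assms by simp
  show "d - ln d \<le> x - ln x" using ln ln_le_minus_one[OF pos] le by linarith
  assume "d - ln d = x - ln x"
  then have "ln (x / d) = x / d - 1" using ln ln_le_minus_one[OF pos] le by linarith
  then have "x / d = 1" using ln_eq_minus_one pos by blast
  then show "d = x" using assms by simp
qed

text \<open>Only one copy of x is removed. Any further copies of x remain subject to the condition
  in the equality case, so that x > 1 is forced to be simple there.\<close>

lemma energy_lower_bound:
  fixes G :: "('a, 'b) pre_digraph" and d :: real
  assumes G: "graph G" and x: "x \<in># graph_spectrum G" and d: "1 \<le> d" "d \<le> x"
  defines "b \<equiv> d + real (card (verts G)) - real (nullity G) - 1
      + ln (cmod (Upsilon (card (verts G) - nullity G) (adjacency_matrix G))) - ln d"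
  shows "b \<le> energy G"
    and "energy G = b \<longleftrightarrow> d = x \<and> (\<forall>y\<in>#graph_spectrum G - {#x#}. y \<in> {-1, 0, 1})"
proof -
  let ?S = "graph_spectrum G" and ?T = "graph_spectrum G - {#x#}"
  have "card (verts G) = size (filter_mset (\<lambda>x. x \<noteq> 0) ?S) + nullity G"
    using size_filter_nonzero[of ?S]
    by (simp add: size_graph_spectrum[OF G] nullity_graph_spectrum[OF G])
  then have "energy G = real (card (verts G)) - real (nullity G)
      + ln (cmod (Upsilon (card (verts G) - nullity G) (adjacency_matrix G))) + (\<Sum>x\<in>#?S. energy_gap x)"
    unfolding energy_graph_spectrum[OF G] Upsilon_graph_spectrum[OF G] sum_abs_energy_gap by simp
  moreover have "(\<Sum>x\<in>#?S. energy_gap x) = energy_gap x + (\<Sum>y\<in>#?T. energy_gap y)"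
    by (subst insert_DiffM[OF x, symmetric]) simp
  moreover have "energy_gap x = x - 1 - ln x" using d by (simp add: energy_gap_def)
  ultimately have E: "energy G - b = (x - ln x - (d - ln d)) + (\<Sum>y\<in>#?T. energy_gap y)"
    unfolding b_def by simp
  have nn: "(\<Sum>y\<in>#M. energy_gap y) \<ge> 0" for M
    by (induction M) (auto intro: add_nonneg_nonneg energy_gap_nonneg)
  have zero: "(\<Sum>y\<in>#M. energy_gap y) = 0 \<longleftrightarrow> (\<forall>y\<in>#M. y \<in> {-1, 0, 1})" for M
    by (induction M)
      (simp_all add: add_nonneg_eq_0_iff[OF energy_gap_nonneg nn] energy_gap_eq_0_iff del: insert_iff)
  show "b \<le> energy G" using E nn[of ?T] diff_ln_mono(1)[OF d] by linarith
  have "energy G = b \<longleftrightarrow> x - ln x - (d - ln d) = 0 \<and> (\<Sum>y\<in>#?T. energy_gap y) = 0"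
  proof -
    have "energy G = b \<longleftrightarrow> (x - ln x - (d - ln d)) + (\<Sum>y\<in>#?T. energy_gap y) = 0"
      by (simp flip: E)
    moreover have "x - ln x - (d - ln d) \<ge> 0" using diff_ln_mono(1)[OF d] by simp
    ultimately show ?thesis using nn[of ?T] by (simp add: add_nonneg_eq_0_iff)
  qed
  also have "x - ln x - (d - ln d) = 0 \<longleftrightarrow> d = x" using diff_ln_mono(2)[OF d] by auto
  finally show "energy G = b \<longleftrightarrow> d = x \<and> (\<forall>y\<in>#?T. y \<in> {-1, 0, 1})" by (simp only: zero)
qed

section \<open>Paths on three vertices excluded by test vectors\<close>

context
  fixes G :: "('a, 'b) pre_digraph"
  assumes G: "graph G"
begin

text \<open>The indicator of {u, v, w} has squared norm 3, but two edges at u already contribute 4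
  to the form. A further edge between v and w can only increase it.\<close>

lemma adj_unique_if_spectrum_le_1:
  assumes le: "\<And>\<mu>. \<mu> \<in># graph_spectrum G \<Longrightarrow> \<mu> \<le> 1" and adj: "u \<rightarrow>\<^bsub>G\<^esub> v" "u \<rightarrow>\<^bsub>G\<^esub> w"
  shows "v = w"
proof (rule ccontr)
  assume neq: "v \<noteq> w"
  let ?A = "{u, v, w}" and ?P = "{(u, v), (v, u), (u, w), (w, u)}"
  let ?x = "\<lambda>z. of_bool (z \<in> ?A) :: real"
  have sym: "v \<rightarrow>\<^bsub>G\<^esub> u" "w \<rightarrow>\<^bsub>G\<^esub> u" using adj graph_adj_sym[OF G] by blast+
  have ne: "u \<noteq> v" "u \<noteq> w" using adj graph_adj_irrefl[OF G] by auto
  have "4 = (\<Sum>(y, z)\<in>?P. ?x y * ?x z)" using ne neq by simp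
  also have "\<dots> \<le> (\<Sum>(y, z) | y \<rightarrow>\<^bsub>G\<^esub> z. ?x y * ?x z)"
    using adj sym by (intro sum_mono2 finite_adj_pairs[OF G]) auto
  also have "\<dots> \<le> (\<Sum>z\<in>verts G. (?x z)\<^sup>2)" using rayleigh_graph[OF G, of 1 1 ?x] le by simp
  also have "\<dots> = (\<Sum>z\<in>?A. 1)"
    by (rule sum.mono_neutral_cong_right)
      (use adj graph_adj_in_verts[OF G] graph_finite_verts[OF G] in auto)
  also have "\<dots> = 3" using ne neq by simp
  finally show False by simp
qed

text \<open>On an induced path the weights 1, -1, 1 give form -4 and squared norm 3, against the
  lower bound -3. Non-adjacency of the ends is what makes the form exactly -4. Adjacency is
  therefore transitive on distinct vertices, and components are cliques.\<close>

lemma adj_trans_if_spectrum_ge_minus_1: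
  assumes ge: "\<And>\<mu>. \<mu> \<in># graph_spectrum G \<Longrightarrow> -1 \<le> \<mu>"
    and adj: "u \<rightarrow>\<^bsub>G\<^esub> v" "v \<rightarrow>\<^bsub>G\<^esub> w" and neq: "u \<noteq> w"
  shows "u \<rightarrow>\<^bsub>G\<^esub> w"
proof (rule ccontr)
  assume nadj: "\<not> u \<rightarrow>\<^bsub>G\<^esub> w"
  let ?A = "{u, v, w}" and ?P = "{(u, v), (v, u), (v, w), (w, v)}"
  let ?x = "\<lambda>z. if z = v then -1 else if z = u \<or> z = w then 1 else 0 :: real"
  have sym: "v \<rightarrow>\<^bsub>G\<^esub> u" "w \<rightarrow>\<^bsub>G\<^esub> v" and nadj': "\<not> w \<rightarrow>\<^bsub>G\<^esub> u"
    using adj nadj graph_adj_sym[OF G] by blast+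
  have ne: "u \<noteq> v" "v \<noteq> w" using adj graph_adj_irrefl[OF G] by auto
  have "(\<Sum>(y, z) | y \<rightarrow>\<^bsub>G\<^esub> z. ?x y * ?x z) = (\<Sum>(y, z)\<in>?P. ?x y * ?x z)"
    using adj sym nadj nadj' graph_adj_irrefl[OF G]
    by (intro sum.mono_neutral_right finite_adj_pairs[OF G]) (auto split: if_splits)
  also have "\<dots> = -4" using ne neq by simp
  finally have form: "(\<Sum>(y, z) | y \<rightarrow>\<^bsub>G\<^esub> z. ?x y * ?x z) = -4" .
  have "- 1 * \<mu> \<le> 1" if "\<mu> \<in># graph_spectrum G" for \<mu> using ge[OF that] by linarith
  from rayleigh_graph[OF G _ this, of ?x, unfolded form]
  have "4 \<le> (\<Sum>z\<in>verts G. (?x z)\<^sup>2)" by simp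
  also have "\<dots> = (\<Sum>z\<in>?A. 1)"
    by (rule sum.mono_neutral_cong_right)
      (use adj graph_adj_in_verts[OF G] graph_finite_verts[OF G] in auto)
  also have "\<dots> = 3" using ne neq by simp
  finally show False by simp
qed

end

section \<open>Cliques with a matching\<close>

text \<open>S is a clique without edges to the outside, and all other vertices have at most one
  neighbour. The choice S = {} covers a pure matching with isolated vertices, the shape for
  \<open>lambda\<^sub>1 = 1\<close>.\<close>

definition clique_and_matching :: "('a, 'b) pre_digraph \<Rightarrow> 'a set \<Rightarrow> bool" where
  "clique_and_matching G S \<longleftrightarrow> S \<subseteq> verts G \<and> (\<forall>u\<in>S. \<forall>v. u \<rightarrow>\<^bsub>G\<^esub> v \<longleftrightarrow> v \<in> S \<and> v \<noteq> u)
    \<and> (\<forall>u v w. u \<notin> S \<longrightarrow> u \<rightarrow>\<^bsub>G\<^esub> v \<longrightarrow> u \<rightarrow>\<^bsub>G\<^esub> w \<longrightarrow> v = w)"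

definition isolated :: "('a, 'b) pre_digraph \<Rightarrow> 'a set" where
  "isolated G = {v \<in> verts G. \<forall>w. \<not> v \<rightarrow>\<^bsub>G\<^esub> w}"

lemma card_distinct_pairs:
  assumes "finite S"
  shows "card {(u, v). u \<in> S \<and> v \<in> S \<and> v \<noteq> u} = card S * (card S - 1)"
proof -
  have "{(u, v). u \<in> S \<and> v \<in> S \<and> v \<noteq> u} = (SIGMA u:S. S - {u})" by auto
  then show ?thesis using assms by simp
qed

lemma card_distinct_triples:
  assumes "finite S"
  shows "card {(u, v, w). u \<in> S \<and> v \<in> S \<and> w \<in> S \<and> v \<noteq> u \<and> w \<noteq> v \<and> u \<noteq> w}
    = card S * (card S - 1) * (card S - 2)"
proof -
  have "{(u, v, w). u \<in> S \<and> v \<in> S \<and> w \<in> S \<and> v \<noteq> u \<and> w \<noteq> v \<and> u \<noteq> w}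
      = (SIGMA u:S. SIGMA v:S - {u}. S - {u, v})" by auto
  also have "card \<dots> = (\<Sum>u\<in>S. \<Sum>v\<in>S - {u}. card (S - {u, v}))"
    using assms by simp
  also have "\<dots> = (\<Sum>u\<in>S. \<Sum>v\<in>S - {u}. card S - 2)"
    using assms by (intro sum.cong refl) (subst card_Diff_subset; auto)
  also have "\<dots> = card S * (card S - 1) * (card S - 2)"
    using assms by simp
  finally show ?thesis .
qed

text \<open>Relative to one unit per element, each c adds \<open>c\<^sup>2 - 1\<close> and each 0
  removes one. The second moment thus yields the number of zeros when the multiplicity of c is
  known, and conversely; both uses occur.\<close>

lemma sum_squares_unit_multiset:
  fixes T :: "real multiset"
  assumes "\<And>x. x \<in># T \<Longrightarrow> x \<in> {-1, 0, 1, c}" and "c > 1"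
  shows "(\<Sum>x\<in>#T. x\<^sup>2) = real (count T c) * (c\<^sup>2 - 1) + real (size T) - real (count T 0)"
  using assms(1)
proof (induction T)
  case (add x T)
  then have "x \<in> {-1, 0, 1, c}" and "(\<Sum>x\<in>#T. x\<^sup>2)
      = real (count T c) * (c\<^sup>2 - 1) + real (size T) - real (count T 0)" by auto
  then show ?case using assms(2) by (auto simp: algebra_simps)
qed simp

text \<open>Reduces the third moment to the first, which is known because the trace is zero.\<close>

lemma sum_cubes_unit_multiset:
  fixes T :: "real multiset"
  assumes "\<And>x. x \<in># T \<Longrightarrow> x \<in> {-1, 0, 1}"
  shows "(\<Sum>x\<in>#T. x ^ 3) = (\<Sum>x\<in>#T. x)"
  using assms
proof (induction T)
  case (add x T)
  have "x \<in> {-1, 0, 1}" by (rule add.prems) simp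
  then have "x ^ 3 = x" by (auto simp: power3_eq_cube)
  then show ?case using add by simp
qed simp

section \<open>Structure and eigenvalues of a clique with a matching\<close>

context
  fixes G :: "('a, 'b) pre_digraph" and S :: "'a set"
  assumes G: "graph G" and cm: "clique_and_matching G S"
begin

private abbreviation "M \<equiv> verts G - S - isolated G"

private lemma S: "S \<subseteq> verts G" "finite S"
  using cm graph_finite_verts[OF G] finite_subset by (auto simp: clique_and_matching_def)

private lemma adj_S: "u \<in> S \<Longrightarrow> u \<rightarrow>\<^bsub>G\<^esub> v \<longleftrightarrow> v \<in> S \<and> v \<noteq> u"
  using cm by (auto simp: clique_and_matching_def)

private lemma adj_unique: "u \<notin> S \<Longrightarrow> u \<rightarrow>\<^bsub>G\<^esub> v \<Longrightarrow> u \<rightarrow>\<^bsub>G\<^esub> w \<Longrightarrow> v = w"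
  using cm by (auto simp: clique_and_matching_def)

private lemma adj_notin_S: "u \<notin> S \<Longrightarrow> u \<rightarrow>\<^bsub>G\<^esub> v \<Longrightarrow> v \<notin> S"
  using adj_S graph_adj_sym[OF G] by blast

text \<open>Meaningful on the matched vertices M only, where the neighbour exists and is
  unique.\<close>

private definition "mate u = (SOME v. u \<rightarrow>\<^bsub>G\<^esub> v)"

private lemma adj_mate_iff:
  assumes "u \<in> M"
  shows "u \<rightarrow>\<^bsub>G\<^esub> v \<longleftrightarrow> v = mate u"
proof -
  have "\<exists>v. u \<rightarrow>\<^bsub>G\<^esub> v" using assms by (auto simp: isolated_def)
  then have "u \<rightarrow>\<^bsub>G\<^esub> mate u" unfolding mate_def by (rule someI_ex)
  then show ?thesis using adj_unique assms by blast
qed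

private lemma mate: "u \<in> M \<Longrightarrow> mate u \<in> M \<and> mate u \<noteq> u \<and> mate (mate u) = u"
proof -
  assume u: "u \<in> M"
  then have um: "u \<rightarrow>\<^bsub>G\<^esub> mate u" using adj_mate_iff by blast
  then have mu: "mate u \<rightarrow>\<^bsub>G\<^esub> u" by (rule graph_adj_sym[OF G])
  then have "mate u \<in> M"
    using u um adj_notin_S graph_adj_in_verts[OF G] by (auto simp: isolated_def)
  then show ?thesis using mu adj_mate_iff u um graph_adj_irrefl[OF G] by metis
qed

text \<open>A one-vertex S would itself be isolated and be counted twice; this is the origin of the
  condition \<open>card S \<noteq> 1\<close> in the counting below.\<close>

lemma disjoint_clique_isolated:
  assumes "card S \<noteq> 1"
  shows "S \<inter> isolated G = {}"
proof (rule ccontr)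
  assume "S \<inter> isolated G \<noteq> {}"
  then obtain v where v: "v \<in> S" "\<forall>w. \<not> v \<rightarrow>\<^bsub>G\<^esub> w" by (auto simp: isolated_def)
  then have "S = {v}" using adj_S by blast
  then show False using assms by simp
qed

lemma clique_and_matching_card_verts:
  assumes "card S \<noteq> 1"
  shows "card (verts G) = card S + card (isolated G) + card M"
proof -
  have fin: "finite (isolated G)" "finite M" using graph_finite_verts[OF G] by (auto simp: isolated_def)
  have "verts G = (S \<union> isolated G) \<union> M" using S by (auto simp: isolated_def)
  moreover have "(S \<union> isolated G) \<inter> M = {}" by auto
  ultimately have "card (verts G) = card (S \<union> isolated G) + card M"
    using S fin by (metis card_Un_disjoint finite_UnI)
  also have "card (S \<union> isolated G) = card S + card (isolated G)"
    using S fin disjoint_clique_isolated[OF assms] by (intro card_Un_disjoint) auto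
  finally show ?thesis .
qed

lemma clique_and_matching_card_adj_pairs:
  "card {(u, v). u \<rightarrow>\<^bsub>G\<^esub> v} = card S * (card S - 1) + card M"
proof -
  let ?P = "{(u, v). u \<in> S \<and> v \<in> S \<and> v \<noteq> u}" and ?Q = "(\<lambda>u. (u, mate u)) ` M"
  have "{(u, v). u \<rightarrow>\<^bsub>G\<^esub> v} = ?P \<union> ?Q"
  proof -
    have "u \<rightarrow>\<^bsub>G\<^esub> v \<longleftrightarrow> (u, v) \<in> ?P \<or> (u, v) \<in> ?Q" for u v
    proof (cases "u \<in> S")
      case True
      then show ?thesis using adj_S[of u v] by auto
    next
      case False
      have "(u, v) \<in> ?Q \<longleftrightarrow> u \<in> M \<and> v = mate u" by auto
      moreover have "\<not> u \<rightarrow>\<^bsub>G\<^esub> v" if "u \<notin> M"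
        using that False graph_adj_in_verts(1)[OF G, of u v] by (auto simp: isolated_def)
      ultimately show ?thesis using adj_mate_iff[of u v] False by blast
    qed
    then show ?thesis by blast
  qed
  moreover have "finite ?P" by (rule finite_subset[of _ "S \<times> S"]) (use S in auto)
  moreover have "finite ?Q" using graph_finite_verts[OF G] by auto
  moreover have "?P \<inter> ?Q = {}" by auto
  moreover have "card ?Q = card M" by (rule card_image) (auto simp: inj_on_def)
  ultimately have "card {(u, v). u \<rightarrow>\<^bsub>G\<^esub> v} = card ?P + card M"
    by (simp only: card_Un_disjoint)
  then show ?thesis unfolding card_distinct_pairs[OF S(2)] .
qed

text \<open>Look at a vertex w where the eigenvector f is nonzero. An isolated w gives \<mu> = 0,
  and a matched w gives \<mu>^2 = 1 by applying the equation at w and at its mate. In S, either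
  \<mu> = -1 or f is constant on S and \<mu> + 1 = \<open>card S\<close>.\<close>

lemma clique_and_matching_spectrum:
  assumes "\<mu> \<in># graph_spectrum G"
  shows "\<mu> \<in> {-1, 0, 1, real (card S) - 1}"
proof -
  obtain f w where w: "w \<in> verts G" "f w \<noteq> 0"
    and ev: "\<And>u. u \<in> verts G \<Longrightarrow> (\<Sum>v | u \<rightarrow>\<^bsub>G\<^esub> v. f v) = complex_of_real \<mu> * f u"
    using graph_spectrum_eigenvector[OF G assms] by metis
  show ?thesis
  proof (cases "w \<in> S")
    case True
    \<comment> \<open>Adding f u to both sides turns the sum over the neighbours of u into the sum
      over S, which is the same for all u.\<close>
    have row: "of_real (\<mu> + 1) * f u = (\<Sum>v\<in>S. f v)" if u: "u \<in> S" for u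
    proof -
      have "{v. u \<rightarrow>\<^bsub>G\<^esub> v} = S - {u}" using adj_S[OF u] by auto
      then have "(\<Sum>v\<in>S - {u}. f v) = of_real \<mu> * f u" using ev[of u] S u by auto
      then show ?thesis using S u by (simp add: sum.remove[of S u] algebra_simps)
    qed
    show ?thesis
    proof (cases "\<mu> = -1")
      case False
      then have "\<mu> + 1 \<noteq> 0" by linarith
      then have "f u = f w" if "u \<in> S" for u
        using row[OF that] row[OF True] by (metis mult_left_cancel of_real_eq_0_iff)
      then have "(\<Sum>v\<in>S. f v) = of_real (card S) * f w" by simp
      then have "complex_of_real (\<mu> + 1) = of_real (card S)"
        using row[OF True] w(2) by (metis mult_right_cancel)
      then have "\<mu> + 1 = real (card S)" by (metis of_real_eq_iff of_real_of_nat_eq)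
      then show ?thesis by simp
    qed simp
  next
    case False
    show ?thesis
    proof (cases "w \<in> isolated G")
      case True
      then have "{v. w \<rightarrow>\<^bsub>G\<^esub> v} = {}" by (auto simp: isolated_def)
      then show ?thesis using ev[OF w(1)] w(2) by simp
    next
      case isol: False
      have M: "w \<in> M" using w False isol by simp
      have "(\<Sum>v | u \<rightarrow>\<^bsub>G\<^esub> v. f v) = f (mate u)" if "u \<in> M" for u
        using adj_mate_iff[OF that] by simp
      then have "f (mate w) = of_real \<mu> * f w" "f w = of_real \<mu> * f (mate w)"
        using ev[of w] ev[of "mate w"] M mate[OF M] by (metis DiffD1)+
      then have "of_real (\<mu> * \<mu>) * f w = 1 * f w" by simp
      then have "complex_of_real (\<mu> * \<mu>) = of_real 1" using w(2) by (metis mult_right_cancel of_real_1)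
      then have "\<mu> * \<mu> = 1" by (metis of_real_eq_iff)
      then show ?thesis by (auto simp: square_eq_1_iff)
    qed
  qed
qed

lemma clique_and_matching_bijections:
  obtains hS :: "'a \<Rightarrow> nat" and hI hM :: "'a \<Rightarrow> nat \<times> nat" where
    "bij_betw hS S {..<card S}"
    "bij_betw hI (isolated G) ({..<card (isolated G)} \<times> {..<1})"
    "bij_betw hM M ({..<card M div 2} \<times> {..<2})" "even (card M)"
    "\<And>u v. u \<in> M \<Longrightarrow> v \<in> M \<Longrightarrow> u \<rightarrow>\<^bsub>G\<^esub> v \<longleftrightarrow> fst (hM u) = fst (hM v) \<and> snd (hM u) \<noteq> snd (hM v)"
proof -
  obtain hS where hS: "bij_betw hS S {..<card S}"
    using ex_bij_betw_finite_nat[OF S(2)] by (auto simp: atLeast0LessThan)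
  have "finite (isolated G)" using graph_finite_verts[OF G] by (auto simp: isolated_def)
  then obtain k where k: "bij_betw k (isolated G) {..<card (isolated G)}"
    using ex_bij_betw_finite_nat by (metis atLeast0LessThan)
  have hI: "bij_betw (\<lambda>v. (k v, 0 :: nat)) (isolated G) ({..<card (isolated G)} \<times> {..<1})"
    using k by (auto simp: bij_betw_def inj_on_def image_iff)
  have fin: "finite M" using graph_finite_verts[OF G] by auto
  obtain hM :: "'a \<Rightarrow> nat \<times> nat" where hM: "even (card M)"
      "bij_betw hM M ({..<card M div 2} \<times> {..<2})"
      "\<And>u v. u \<in> M \<Longrightarrow> v \<in> M \<Longrightarrow> v = mate u \<longleftrightarrow> fst (hM u) = fst (hM v) \<and> snd (hM u) \<noteq> snd (hM v)"
    using perfect_matching_bijection[OF fin mate] by metis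
  show ?thesis using that[OF hS hI hM(2,1)] hM(3) adj_mate_iff by blast
qed

lemma clique_and_matching_adj_cases:
  "u \<rightarrow>\<^bsub>G\<^esub> v \<longleftrightarrow> u \<in> S \<and> v \<in> S \<and> v \<noteq> u \<or> u \<in> M \<and> v \<in> M \<and> u \<rightarrow>\<^bsub>G\<^esub> v"
proof (cases "u \<in> S")
  case True
  then show ?thesis using adj_S by auto
next
  case False
  have "u \<in> M \<and> v \<in> M" if "u \<rightarrow>\<^bsub>G\<^esub> v"
  proof -
    have u: "u \<in> M" using that False graph_adj_in_verts(1)[OF G that] by (auto simp: isolated_def)
    have "v = mate u" using adj_mate_iff[OF u] that by blast
    then show ?thesis using mate[OF u] u by blast
  qed
  then show ?thesis using False by blast
qed

end

text \<open>Not an instance of the clique version with S = {}: that target has an extra empty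
  summand and lists the two families in the opposite order.\<close>

lemma matching_isomorphism:
  assumes G: "graph G" and cm: "clique_and_matching G {}"
  shows "digraph_iso G (copies ((card (verts G) - card (isolated G)) div 2) (complete_graph 2)
    \<uplus>\<^sub>G copies (card (isolated G)) (complete_graph 1))" (is "digraph_iso G ?H")
proof -
  let ?I = "isolated G" and ?M = "verts G - {} - isolated G"
  obtain hI hM :: "'a \<Rightarrow> nat \<times> nat" where
    hI: "bij_betw hI ?I ({..<card ?I} \<times> {..<1})" and
    hM: "bij_betw hM ?M ({..<card ?M div 2} \<times> {..<2})" and
    adj: "\<And>u v. u \<in> ?M \<Longrightarrow> v \<in> ?M \<Longrightarrow> u \<rightarrow>\<^bsub>G\<^esub> v \<longleftrightarrow> fst (hM u) = fst (hM v) \<and> snd (hM u) \<noteq> snd (hM v)"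
    using clique_and_matching_bijections[OF G cm] by metis
  have card_M: "card ?M = card (verts G) - card ?I"
    using clique_and_matching_card_verts[OF G cm] by simp
  define h where "h x = (if x \<in> ?M then Inl (hM x) else Inr (hI x))" for x
  have "bij_betw h (?M \<union> ?I) (({..<card ?M div 2} \<times> {..<2}) <+> ({..<card ?I} \<times> {..<1}))"
    unfolding h_def by (rule bij_betw_sum[OF hM hI]) auto
  moreover have "?M \<union> ?I = verts G" by (auto simp: isolated_def)
  ultimately have h: "bij_betw h (verts G) (verts ?H)"
    unfolding verts_constructions card_M by simp
  have bounds: "hM u \<in> {..<card ?M div 2} \<times> {..<2}" if "u \<in> ?M" for u
    using bij_betwE[OF hM] that by blast
  have small: "hI u \<in> {..<card ?I} \<times> {..<1}" if "u \<in> ?I" for u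
    using bij_betwE[OF hI] that by blast
  have "u \<rightarrow>\<^bsub>G\<^esub> v \<longleftrightarrow> h u \<rightarrow>\<^bsub>?H\<^esub> h v" if uv: "u \<in> verts G" "v \<in> verts G" for u v
  proof (cases "u \<in> ?M \<and> v \<in> ?M")
    case True
    then show ?thesis
      using adj[of u v] bounds[of u] bounds[of v] card_M
      by (cases "hM u"; cases "hM v") (auto simp: h_def adj_disjoint_union adj_copies adj_complete_graph)
  next
    case False
    then have "\<not> u \<rightarrow>\<^bsub>G\<^esub> v" using clique_and_matching_adj_cases[OF G cm, of u v] by auto
    moreover have "\<not> h u \<rightarrow>\<^bsub>?H\<^esub> h v"
      using False uv small[of u] small[of v]
      by (cases "hI u"; cases "hI v") (auto simp: h_def adj_disjoint_union adj_copies adj_complete_graph)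
    ultimately show ?thesis by blast
  qed
  moreover have "nomulti_digraph ?H"
    by (intro nomulti_disjoint_union nomulti_copies graph_nomulti graph_complete_graph)
  ultimately obtain f where "pre_digraph.digraph_isomorphism G f" "app_iso f G = ?H"
    using vertex_bijection_digraph_isomorphism[OF graph_nomulti[OF G] _ h] by metis
  then show ?thesis unfolding digraph_iso_def by metis
qed

text \<open>The isomorphism is exposed, together with the image of S, because the equality case must
  say which component of G becomes the clique.\<close>

lemma clique_and_matching_isomorphism:
  assumes G: "graph G" and cm: "clique_and_matching G S" and S: "card S \<noteq> 1"
  obtains f where "pre_digraph.digraph_isomorphism G f"
    "app_iso f G = complete_graph (card S) \<uplus>\<^sub>G copies (card (isolated G)) (complete_graph 1)
      \<uplus>\<^sub>G copies ((card (verts G) - card S - card (isolated G)) div 2) (complete_graph 2)"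
    "iso_verts f ` S = Inl ` verts (complete_graph (card S))"
proof -
  let ?I = "isolated G" and ?M = "verts G - S - isolated G"
  obtain hS and hI hM :: "'a \<Rightarrow> nat \<times> nat" where
    hS: "bij_betw hS S {..<card S}" and
    hI: "bij_betw hI ?I ({..<card ?I} \<times> {..<1})" and
    hM: "bij_betw hM ?M ({..<card ?M div 2} \<times> {..<2})" and
    adj: "\<And>u v. u \<in> ?M \<Longrightarrow> v \<in> ?M \<Longrightarrow> u \<rightarrow>\<^bsub>G\<^esub> v \<longleftrightarrow> fst (hM u) = fst (hM v) \<and> snd (hM u) \<noteq> snd (hM v)"
    using clique_and_matching_bijections[OF G cm] by metis
  let ?H = "complete_graph (card S) \<uplus>\<^sub>G copies (card (isolated G)) (complete_graph 1)
      \<uplus>\<^sub>G copies ((card (verts G) - card S - card (isolated G)) div 2) (complete_graph 2)"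
  have card_M: "card ?M = card (verts G) - card S - card ?I"
    using clique_and_matching_card_verts[OF G cm S] by simp
  have SI: "S \<inter> ?I = {}" by (rule disjoint_clique_isolated[OF G cm S])
  define h where "h x = (if x \<in> S then Inl (hS x) else Inr (if x \<in> ?I then Inl (hI x) else Inr (hM x)))" for x
  have "bij_betw h (S \<union> (?I \<union> ?M))
      ({..<card S} <+> ({..<card ?I} \<times> {..<1}) <+> ({..<card ?M div 2} \<times> {..<2}))"
    unfolding h_def using SI by (intro bij_betw_sum hS hI hM) auto
  moreover have "S \<union> (?I \<union> ?M) = verts G"
    using cm by (auto simp: isolated_def clique_and_matching_def)
  ultimately have h: "bij_betw h (verts G) (verts ?H)"
    unfolding verts_constructions card_M by simp
  have bounds: "hM u \<in> {..<card ?M div 2} \<times> {..<2}" if "u \<in> ?M" for u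
    using bij_betwE[OF hM] that by blast
  have small: "hI u \<in> {..<card ?I} \<times> {..<1}" if "u \<in> ?I" for u
    using bij_betwE[OF hI] that by blast
  have hS_lt: "hS u < card S" if "u \<in> S" for u using hS that by (auto simp: bij_betw_def)
  have hS_inj: "hS u = hS v \<longleftrightarrow> u = v" if "u \<in> S" "v \<in> S" for u v
    using hS that by (auto simp: bij_betw_def inj_on_def)
  have "u \<rightarrow>\<^bsub>G\<^esub> v \<longleftrightarrow> h u \<rightarrow>\<^bsub>?H\<^esub> h v" if uv: "u \<in> verts G" "v \<in> verts G" for u v
  proof -
    consider "u \<in> S" "v \<in> S" | "u \<in> ?M" "v \<in> ?M"
      | "\<not> (u \<in> S \<and> v \<in> S)" "\<not> (u \<in> ?M \<and> v \<in> ?M)" by blast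
    then show ?thesis
    proof cases
      case 1
      then show ?thesis
        using clique_and_matching_adj_cases[OF G cm, of u v] hS_lt hS_inj
        by (auto simp: h_def adj_disjoint_union adj_complete_graph)
    next
      case 2
      then show ?thesis
        using adj[of u v] bounds[of u] bounds[of v] card_M
        by (cases "hM u"; cases "hM v") (auto simp: h_def adj_disjoint_union adj_copies adj_complete_graph)
    next
      case 3
      then have "\<not> u \<rightarrow>\<^bsub>G\<^esub> v" using clique_and_matching_adj_cases[OF G cm, of u v] by blast
      moreover have "\<not> h u \<rightarrow>\<^bsub>?H\<^esub> h v"
        using 3 uv small[of u] small[of v]
        by (cases "hI u"; cases "hI v") (auto simp: h_def adj_disjoint_union adj_copies adj_complete_graph)
      ultimately show ?thesis by blast
    qed
  qed
  moreover have "nomulti_digraph ?H"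
    by (intro nomulti_disjoint_union nomulti_copies graph_nomulti graph_complete_graph)
  ultimately obtain f where f: "pre_digraph.digraph_isomorphism G f" "app_iso f G = ?H" "iso_verts f = h"
    using vertex_bijection_digraph_isomorphism[OF graph_nomulti[OF G] _ h] by metis
  have "h ` S = Inl ` hS ` S" unfolding image_image by (intro image_cong) (auto simp: h_def)
  also have "hS ` S = verts (complete_graph (card S))"
    using hS by (simp add: bij_betw_def verts_constructions)
  finally show ?thesis using that f by metis
qed

text \<open>No vertex has two neighbours, so all eigenvalues are -1, 0 or 1. The second moment is
  then n - \<kappa>, and it also counts the non-isolated vertices.\<close>

lemma matching_of_spectrum_le_1:
  assumes G: "graph G" and le: "\<And>\<mu>. \<mu> \<in># graph_spectrum G \<Longrightarrow> \<mu> \<le> 1"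
  shows "clique_and_matching G {}" "card (isolated G) = nullity G"
    and "\<And>\<mu>. \<mu> \<in># graph_spectrum G \<Longrightarrow> \<mu> \<in> {-1, 0, 1}"
proof -
  show cm: "clique_and_matching G {}"
    using adj_unique_if_spectrum_le_1[OF G le] by (auto simp: clique_and_matching_def)
  show ev: "\<mu> \<in> {-1, 0, 1}" if "\<mu> \<in># graph_spectrum G" for \<mu>
    using clique_and_matching_spectrum[OF G cm that] by auto
  let ?M = "verts G - {} - isolated G"
  \<comment> \<open>The value 2 only fills the place of c in
    \<open>sum_squares_unit_multiset\<close>: it exceeds 1 and has multiplicity zero.\<close>
  have "2 \<notin># graph_spectrum G" using le by force
  moreover have "\<mu> \<in> {-1, 0, 1, 2}" if "\<mu> \<in># graph_spectrum G" for \<mu> using ev[OF that] by auto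
  ultimately have "(\<Sum>x\<in>#graph_spectrum G. x\<^sup>2) = real (card (verts G)) - real (nullity G)"
    using sum_squares_unit_multiset[of "graph_spectrum G" 2]
    by (simp add: size_graph_spectrum[OF G] nullity_graph_spectrum[OF G] not_in_iff)
  moreover have "(\<Sum>x\<in>#graph_spectrum G. x\<^sup>2) = real (card ?M)"
    unfolding sum_graph_spectrum_2[OF G] clique_and_matching_card_adj_pairs[OF G cm] by simp
  moreover have "card (verts G) = card (isolated G) + card ?M"
    using clique_and_matching_card_verts[OF G cm] by simp
  ultimately show "card (isolated G) = nullity G" by linarith
qed

lemma clique_component_of_spectrum:
  fixes G G\<^sub>1 :: "('a, 'b) pre_digraph"
  assumes G: "graph G" and G1: "G\<^sub>1 \<in> pre_digraph.sccs G"
    and x: "x \<in># graph_spectrum G" "x > 1"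
    and unit: "\<And>y. y \<in># graph_spectrum G - {#x#} \<Longrightarrow> y \<in> {-1, 0, 1}"
    and avg: "2 * real (card (edges G\<^sub>1)) / real (card (verts G\<^sub>1)) = x"
  shows "clique_and_matching G (verts G\<^sub>1)" "card (verts G\<^sub>1) \<ge> 3" "card (isolated G) = nullity G"
proof -
  let ?V = "verts G\<^sub>1" and ?S = "graph_spectrum G" and ?T = "graph_spectrum G - {#x#}"
  define s where "s = card ?V"
  have spec: "?S = add_mset x ?T" using x by simp
  have "-1 \<le> \<mu>" if "\<mu> \<in># ?S" for \<mu>
    using that unit[of \<mu>] x(2) by (cases "\<mu> = x") (auto simp: in_diff_count)
  note adj_trans = adj_trans_if_spectrum_ge_minus_1[OF G this]
  have fin: "finite ?V" by (rule finite_component[OF G G1])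
  have clique: "u \<rightarrow>\<^bsub>G\<^esub> v \<longleftrightarrow> v \<in> ?V \<and> v \<noteq> u" if u: "u \<in> ?V" for u v
  proof
    assume "u \<rightarrow>\<^bsub>G\<^esub> v"
    then show "v \<in> ?V \<and> v \<noteq> u"
      using component_closed[OF G G1 u] graph_adj_irrefl[OF G] by auto
  next
    assume v: "v \<in> ?V \<and> v \<noteq> u"
    \<comment> \<open>By transitivity, u and its neighbours form an adjacency-closed set, which
      therefore contains the component.\<close>
    have "?V \<subseteq> {w. w = u \<or> u \<rightarrow>\<^bsub>G\<^esub> w}"
      by (rule component_subset[OF G G1 u]) (use adj_trans in blast)+
    then show "u \<rightarrow>\<^bsub>G\<^esub> v" using v by auto
  qed
  have "{(u, v). u \<rightarrow>\<^bsub>G\<^sub>1\<^esub> v} = {(u, v). u \<in> ?V \<and> v \<in> ?V \<and> v \<noteq> u}"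
    using clique by (auto simp: component_adj_iff[OF G G1])
  then have "2 * card (edges G\<^sub>1) = s * (s - 1)"
    using card_component_adj_pairs[OF G G1] card_distinct_pairs[OF fin] by (simp add: s_def)
  then have "2 * real (card (edges G\<^sub>1)) = real s * real (s - 1)"
    by (metis of_nat_mult of_nat_numeral)
  \<comment> \<open>For s = 0 the quotient in \<open>avg\<close> would be 0, as division by zero is,
    contradicting x > 1.\<close>
  then have xs: "x = real (s - 1)" using avg x(2) by (cases "s = 0") (auto simp: s_def)
  then have s3: "s \<ge> 3" using x(2) by linarith
  then have xs': "x = real s - 1" using xs by simp
  show "card ?V \<ge> 3" using s3 by (simp add: s_def)

  let ?Tri = "{(u, v, w). u \<rightarrow>\<^bsub>G\<^esub> v \<and> v \<rightarrow>\<^bsub>G\<^esub> w \<and> w \<rightarrow>\<^bsub>G\<^esub> u}"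
  let ?TV = "{(u, v, w). u \<in> ?V \<and> v \<in> ?V \<and> w \<in> ?V \<and> v \<noteq> u \<and> w \<noteq> v \<and> u \<noteq> w}"
  have fin_Tri: "finite ?Tri"
    by (rule finite_subset[of _ "verts G \<times> verts G \<times> verts G"])
      (auto simp: graph_finite_verts[OF G] dest: graph_adj_in_verts[OF G])
  have sub: "?TV \<subseteq> ?Tri" using clique by auto
  have "real (card ?Tri) = x ^ 3 + (\<Sum>y\<in>#?T. y)"
    unfolding sum_graph_spectrum_3[OF G, symmetric]
    by (subst spec) (simp add: sum_cubes_unit_multiset[OF unit])
  also have "(\<Sum>y\<in>#?T. y) = - x"
  proof -
    have "(\<Sum>y\<in>#?S. y) = x + (\<Sum>y\<in>#?T. y)" by (subst spec) simp
    then show ?thesis using sum_graph_spectrum[OF G] by simp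
  qed
  also have "x ^ 3 + - x = real s * (real s - 1) * (real s - 2)"
    unfolding xs' by (simp add: power3_eq_cube algebra_simps)
  also have "\<dots> = real (s * (s - 1) * (s - 2))" using s3 by (simp add: of_nat_diff)
  also have "s * (s - 1) * (s - 2) = card ?TV"
    unfolding s_def by (rule card_distinct_triples[OF fin, symmetric])
  finally have Tri: "?Tri = ?TV" using card_subset_eq[OF fin_Tri sub] by simp

  show cm: "clique_and_matching G ?V"
    unfolding clique_and_matching_def
  proof (intro conjI ballI allI impI)
    show "?V \<subseteq> verts G" by (rule component_verts_subset[OF G G1])
    fix u v show "u \<in> ?V \<Longrightarrow> u \<rightarrow>\<^bsub>G\<^esub> v \<longleftrightarrow> v \<in> ?V \<and> v \<noteq> u" by (rule clique)
  next
    fix u v w assume uvw: "u \<notin> ?V" "u \<rightarrow>\<^bsub>G\<^esub> v" "u \<rightarrow>\<^bsub>G\<^esub> w"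
    show "v = w"
    proof (rule ccontr)
      assume "v \<noteq> w"
      \<comment> \<open>Two neighbours of u are adjacent by transitivity and close a triangle
        through u, although all triangles lie in the component.\<close>
      then have "v \<rightarrow>\<^bsub>G\<^esub> w" using adj_trans uvw graph_adj_sym[OF G] by blast
      then have "(u, v, w) \<in> ?Tri" using uvw graph_adj_sym[OF G] by simp
      then show False using uvw(1) unfolding Tri by simp
    qed
  qed

  let ?M = "verts G - ?V - isolated G"
  have "x \<notin># ?T" using unit[of x] x(2) by auto
  then have "count ?T x = 0" by (simp add: not_in_iff)
  moreover have "y \<in> {-1, 0, 1, x}" if "y \<in># ?T" for y using unit[OF that] by auto
  ultimately have "(\<Sum>y\<in>#?T. y\<^sup>2) = real (size ?T) - real (count ?T 0)"
    using sum_squares_unit_multiset[of ?T x] x(2) by simp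
  moreover have "size ?T + 1 = card (verts G)"
    unfolding size_graph_spectrum[OF G, symmetric] by (subst (2) spec) simp
  moreover have "count ?T 0 = nullity G"
    using x(2) by (simp add: nullity_graph_spectrum[OF G])
  moreover have "(\<Sum>y\<in>#?S. y\<^sup>2) = x\<^sup>2 + (\<Sum>y\<in>#?T. y\<^sup>2)" by (subst spec) simp
  moreover have "(\<Sum>y\<in>#?S. y\<^sup>2) = real (s * (s - 1) + card ?M)"
    unfolding sum_graph_spectrum_2[OF G] clique_and_matching_card_adj_pairs[OF G cm] s_def ..
  moreover have "card (verts G) = s + card (isolated G) + card ?M"
    unfolding s_def using s3 by (intro clique_and_matching_card_verts[OF G cm]) (simp add: s_def)
  moreover have "real (s * (s - 1)) = x\<^sup>2 + real s - 1"
    using s3 by (simp add: xs' of_nat_diff power2_eq_square algebra_simps)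
  \<comment> \<open>With I the isolated vertices, the two evaluations of the second moment give
    \<open>x\<^sup>2\<close> + n - 1 - \<kappa> = s (s - 1) + card M. Inserting s (s - 1) =
    \<open>x\<^sup>2\<close> + s - 1 and n = s + card I + card M leaves card I = \<kappa>.\<close>
  ultimately show "card (isolated G) = nullity G"
    by (smt (verit) of_nat_add of_nat_1 of_nat_eq_iff)
qed

lemma clique_and_matching_unit_spectrum:
  assumes G: "graph G" and cm: "clique_and_matching G S" and S: "card S \<ge> 3"
    and null: "card (isolated G) = nullity G"
  defines "c \<equiv> real (card S) - 1"
  shows "c \<in># graph_spectrum G" "\<And>y. y \<in># graph_spectrum G - {#c#} \<Longrightarrow> y \<in> {-1, 0, 1}"
proof -
  let ?S = "graph_spectrum G" and ?M = "verts G - S - isolated G"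
  define s where "s = real (card S)"
  have c: "c = s - 1" "s \<ge> 3" using S by (auto simp: c_def s_def)
  have ev: "y \<in> {-1, 0, 1, c}" if "y \<in># ?S" for y
    using clique_and_matching_spectrum[OF G cm that] by (simp add: c_def)
  have "(\<Sum>y\<in>#?S. y\<^sup>2) = real (count ?S c) * (c\<^sup>2 - 1) + real (card (verts G)) - real (nullity G)"
    using sum_squares_unit_multiset[OF ev] c
    by (simp add: size_graph_spectrum[OF G] nullity_graph_spectrum[OF G])
  moreover have "(\<Sum>y\<in>#?S. y\<^sup>2) = s * (s - 1) + real (card ?M)"
    unfolding sum_graph_spectrum_2[OF G] clique_and_matching_card_adj_pairs[OF G cm] s_def
    using S by (simp add: of_nat_diff)
  moreover have "real (card (verts G)) = s + real (nullity G) + real (card ?M)"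
    using clique_and_matching_card_verts[OF G cm] S by (simp add: null s_def)
  ultimately have "real (count ?S c) * (c\<^sup>2 - 1) = s * (s - 2)"
    by (simp add: algebra_simps)
  moreover have "c\<^sup>2 - 1 = s * (s - 2)" by (simp add: c power2_eq_square algebra_simps)
  \<comment> \<open>The factor s (s - 2) can be cancelled because s \<ge> 3 makes it
    positive.\<close>
  ultimately have count: "count ?S c = 1" using c by simp
  then show "c \<in># ?S" by (simp flip: count_greater_zero_iff)
  fix y assume y: "y \<in># ?S - {#c#}"
  then have "y \<noteq> c" using count by (metis count_diff count_single diff_self_eq_0 not_in_iff)
  then show "y \<in> {-1, 0, 1}" using ev[of y] y by (auto dest: in_diffD)
qed

text \<open>The constructors of the sum type record the summand in which a vertex lands, so the
  structure of G is read off from h u. With s = 1 the first summand would be one more isolated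
  vertex, spoiling the count k.\<close>

lemma clique_and_matching_of_isomorphism:
  fixes G :: "('a, 'b) pre_digraph"
  assumes G: "graph G" and f: "pre_digraph.digraph_isomorphism G f" and S: "S \<subseteq> verts G"
    and iso: "app_iso f G = complete_graph s \<uplus>\<^sub>G copies k (complete_graph 1) \<uplus>\<^sub>G copies t (complete_graph 2)"
    and image: "iso_verts f ` S = Inl ` verts (complete_graph s)"
    and s: "s \<noteq> 1"
  shows "clique_and_matching G S" "card S = s" "card (isolated G) = k"
proof -
  let ?H = "complete_graph s \<uplus>\<^sub>G copies k (complete_graph 1) \<uplus>\<^sub>G copies t (complete_graph 2)"
  define h where "h = iso_verts f"
  have inj: "inj_on h (verts G)"
    using f unfolding h_def by (rule pre_digraph.digraph_isomorphism_inj_on_verts)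
  have surj: "h ` verts G = verts ?H" unfolding h_def by (metis iso verts_app_iso)
  have adj: "u \<rightarrow>\<^bsub>G\<^esub> v \<longleftrightarrow> h u \<rightarrow>\<^bsub>?H\<^esub> h v" if "u \<in> verts G" "v \<in> verts G" for u v
    using digraph_isomorphism_adj_iff[OF f that] by (simp add: iso h_def)
  have hS: "h ` S = Inl ` {..<s}" using image by (simp add: h_def verts_constructions)
  have in_S: "u \<in> S \<longleftrightarrow> (\<exists>i. h u = Inl i)" if u: "u \<in> verts G" for u
  proof
    assume "\<exists>i. h u = Inl i"
    then obtain i where i: "h u = Inl i" by blast
    have "h u \<in> verts ?H" using surj u by blast
    then have "h u \<in> h ` S" using i by (auto simp: hS verts_constructions)
    then show "u \<in> S" using inj S u by (auto simp: inj_on_def)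
  qed (use hS in blast)
  have "card (h ` S) = card S" by (rule card_image[OF inj_on_subset[OF inj S]])
  then show card_S: "card S = s" by (simp add: hS card_image)
  have cases_notin: "\<exists>i p. h u = Inr (Inl (i, 0)) \<and> i < k \<or> h u = Inr (Inr p) \<and> p \<in> {..<t} \<times> {..<2}"
    if u: "u \<in> verts G" "u \<notin> S" for u
  proof -
    have "h u \<in> verts ?H" using surj u by blast
    then show ?thesis using in_S[OF u(1)] u(2) by (auto simp: verts_constructions)
  qed
  show "clique_and_matching G S"
    unfolding clique_and_matching_def
  proof (intro conjI ballI allI impI)
    fix u v assume u: "u \<in> S"
    then have uV: "u \<in> verts G" using S by blast
    obtain i where i: "h u = Inl i" using in_S[OF uV] u by blast
    show "u \<rightarrow>\<^bsub>G\<^esub> v \<longleftrightarrow> v \<in> S \<and> v \<noteq> u"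
    proof
      assume uv: "u \<rightarrow>\<^bsub>G\<^esub> v"
      then have vV: "v \<in> verts G" by (rule graph_adj_in_verts[OF G])
      have "h u \<rightarrow>\<^bsub>?H\<^esub> h v" using adj[OF uV vV] uv by blast
      then have "\<exists>j. h v = Inl j" by (cases "h v") (auto simp: i adj_disjoint_union)
      then show "v \<in> S \<and> v \<noteq> u" using in_S[OF vV] uv graph_adj_irrefl[OF G] by auto
    next
      assume v: "v \<in> S \<and> v \<noteq> u"
      then have vV: "v \<in> verts G" using S by blast
      obtain j where j: "h v = Inl j" using in_S[OF vV] v by blast
      have "i < s" "j < s" using hS u v i j by (metis Inl_inject image_iff lessThan_iff)+
      moreover have "i \<noteq> j" using inj uV vV v i j by (auto simp: inj_on_def)
      ultimately show "u \<rightarrow>\<^bsub>G\<^esub> v"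
        using adj[OF uV vV] by (simp add: i j adj_disjoint_union adj_complete_graph)
    qed
  next
    fix u v w assume u: "u \<notin> S" and uv: "u \<rightarrow>\<^bsub>G\<^esub> v" and uw: "u \<rightarrow>\<^bsub>G\<^esub> w"
    have V: "u \<in> verts G" "v \<in> verts G" "w \<in> verts G" using uv uw graph_adj_in_verts[OF G] by blast+
    \<comment> \<open>A neighbour of u is the other end of the same copy of the complete graph on
      two vertices. Labels below 2 that differ determine each other, so all neighbours of u have the
      same image.\<close>
    have nbr: "\<exists>i a b. h u = Inr (Inr (i, a)) \<and> h z = Inr (Inr (i, b)) \<and> a < 2 \<and> b < 2 \<and> a \<noteq> b"
      if z: "u \<rightarrow>\<^bsub>G\<^esub> z" for z
    proof -
      have zV: "z \<in> verts G" using z by (rule graph_adj_in_verts[OF G])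
      have hz: "h u \<rightarrow>\<^bsub>?H\<^esub> h z" using adj[OF V(1) zV] z by blast
      obtain i p where "h u = Inr (Inl (i, 0)) \<and> i < k \<or> h u = Inr (Inr p) \<and> p \<in> {..<t} \<times> {..<2}"
        using cases_notin[OF V(1) u] by blast
      then show ?thesis
      proof
        assume hu: "h u = Inr (Inl (i, 0)) \<and> i < k"
        show ?thesis
        proof (cases "h z")
          case (Inl q)
          then show ?thesis using hz hu by (simp add: adj_disjoint_union)
        next
          case (Inr q)
          then show ?thesis
            using hz hu by (cases q) (auto simp: adj_disjoint_union adj_copies adj_complete_graph)
        qed
      next
        assume hu: "h u = Inr (Inr p) \<and> p \<in> {..<t} \<times> {..<2}"
        show ?thesis
        proof (cases "h z")
          case (Inl q)
          then show ?thesis using hz hu by (simp add: adj_disjoint_union)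
        next
          case (Inr q)
          then show ?thesis
            using hz hu by (cases q; cases p)
              (auto simp: adj_disjoint_union adj_copies adj_complete_graph)
        qed
      qed
    qed
    obtain i a b where 1: "h u = Inr (Inr (i, a))" "h v = Inr (Inr (i, b))" "a < 2" "b < 2" "a \<noteq> b"
      using nbr[OF uv] by blast
    obtain j a' b' where 2: "h u = Inr (Inr (j, a'))" "h w = Inr (Inr (j, b'))" "a' < 2" "b' < 2" "a' \<noteq> b'"
      using nbr[OF uw] by blast
    have "h v = h w" using 1 2 by auto
    then show "v = w" using inj V by (auto simp: inj_on_def)
  qed (rule S)
  have "h ` isolated G = Inr ` Inl ` ({..<k} \<times> {..<1})"
  proof
    show "h ` isolated G \<subseteq> Inr ` Inl ` ({..<k} \<times> {..<1})"
    proof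
      fix y assume "y \<in> h ` isolated G"
      then obtain u where u: "u \<in> verts G" "\<And>w. \<not> u \<rightarrow>\<^bsub>G\<^esub> w" "y = h u" by (auto simp: isolated_def)
      \<comment> \<open>S is not a singleton, so a vertex of S would have a neighbour in the
        clique.\<close>
      have uS: "u \<notin> S"
      proof
        assume "u \<in> S"
        then obtain v where "v \<in> S" "v \<noteq> u"
          using card_S s by (metis card_1_singleton_iff One_nat_def is_singletonI' is_singleton_the_elem empty_iff)
        then show False using u(2) \<open>clique_and_matching G S\<close> \<open>u \<in> S\<close>
          by (auto simp: clique_and_matching_def)
      qed
      obtain i p where "h u = Inr (Inl (i, 0)) \<and> i < k \<or> h u = Inr (Inr p) \<and> p \<in> {..<t} \<times> {..<2}"
        using cases_notin[OF u(1) uS] by blast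
      then show "y \<in> Inr ` Inl ` ({..<k} \<times> {..<1})"
      proof
        assume "h u = Inr (Inr p) \<and> p \<in> {..<t} \<times> {..<2}"
        then obtain j a where p: "h u = Inr (Inr (j, a))" "j < t" "a < 2" by (cases p) auto
        \<comment> \<open>On labels 0 and 1, \<open>1 - a\<close> is the other end of the same
          edge.\<close>
        have "Inr (Inr (j, 1 - a)) \<in> verts ?H" using p by (auto simp: verts_constructions)
        then obtain w where w: "w \<in> verts G" "h w = Inr (Inr (j, 1 - a))" using surj by (metis imageE)
        have "a \<noteq> 1 - a" using p by arith
        then have "u \<rightarrow>\<^bsub>G\<^esub> w"
          using adj[OF u(1) w(1)] p w by (simp add: adj_disjoint_union adj_copies adj_complete_graph)
        then show ?thesis using u(2) by blast
      qed (auto simp: u(3))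
    qed
    show "Inr ` Inl ` ({..<k} \<times> {..<1}) \<subseteq> h ` isolated G"
    proof
      fix y :: "nat + (nat \<times> nat) + (nat \<times> nat)" assume "y \<in> Inr ` Inl ` ({..<k} \<times> {..<1})"
      then obtain i where i: "y = Inr (Inl (i, 0))" "i < k" by auto
      then have "y \<in> verts ?H" by (auto simp: verts_constructions)
      then obtain u where u: "u \<in> verts G" "y = h u" using surj by (metis imageE)
      have "\<not> u \<rightarrow>\<^bsub>G\<^esub> w" for w
      proof
        assume uw: "u \<rightarrow>\<^bsub>G\<^esub> w"
        then have "w \<in> verts G" by (rule graph_adj_in_verts[OF G])
        then have hw: "Inr (Inl (i, 0)) \<rightarrow>\<^bsub>?H\<^esub> h w" using adj[OF u(1)] uw u(2) i by simp
        show False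
        proof (cases "h w")
          case (Inl q)
          then show ?thesis using hw by (simp add: adj_disjoint_union)
        next
          case (Inr q)
          then show ?thesis
            using hw by (cases q) (auto simp: adj_disjoint_union adj_copies adj_complete_graph)
        qed
      qed
      then show "y \<in> h ` isolated G" using u by (auto simp: isolated_def)
    qed
  qed
  moreover have "card (h ` isolated G) = card (isolated G)"
    by (rule card_image[OF inj_on_subset[OF inj]]) (auto simp: isolated_def)
  ultimately show "card (isolated G) = k"
    by (simp add: card_image card_cartesian_product)
qed

section \<open>The energy bound and its equality cases\<close>

text \<open>In the last case f is named so that the same isomorphism can send
  \<open>verts G\<^sub>1\<close> onto the clique summand. Writing l + 3 \<le> n avoids truncated
  subtraction, under which n - 3 would be 0 for n < 3.\<close>

theorem corollary7:
  fixes G G\<^sub>1 :: "('a, 'b) pre_digraph"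
    and n m \<kappa> n\<^sub>1 m\<^sub>1 :: nat
    and lambda\<^sub>1 bound :: real
  assumes G: "graph G"
    and n: "n = card (verts G)"
    and m: "m = card (edges G)"
    and lambda1: "lambda\<^sub>1 = largest_eigenvalue G"
    and kappa: "\<kappa> = nullity G"
    and G1: "G\<^sub>1 \<in> pre_digraph.sccs G"
    and n1: "n\<^sub>1 = card (verts G\<^sub>1)" "n\<^sub>1 \<ge> 2"
    and m1: "m\<^sub>1 = card (edges G\<^sub>1)"
    and bound: "bound = 2 * real m\<^sub>1 / real n\<^sub>1 + real n - real \<kappa> - 1
      + ln (cmod (Upsilon (n - \<kappa>) (adjacency_matrix G))) - ln (2 * real m\<^sub>1 / real n\<^sub>1)"
  shows "energy G \<ge> bound
    \<and> (\<forall>r\<^sub>1. regular_graph r\<^sub>1 G\<^sub>1 \<longrightarrow>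
        energy G \<ge> real r\<^sub>1 + real n - real \<kappa> - 1
          + ln (cmod (Upsilon (n - \<kappa>) (adjacency_matrix G))) - ln (real r\<^sub>1))
    \<and> (lambda\<^sub>1 = 1 \<longrightarrow>
        (energy G = bound \<longleftrightarrow>
          digraph_iso G (copies ((n - \<kappa>) div 2) (complete_graph 2) \<uplus>\<^sub>G copies \<kappa> (complete_graph 1))))
    \<and> (lambda\<^sub>1 > 1 \<longrightarrow>
        (energy G = bound \<longleftrightarrow>
          (\<exists>l f. \<kappa> \<le> l \<and> l + 3 \<le> n
            \<and> pre_digraph.digraph_isomorphism G f
            \<and> app_iso f G = complete_graph (n - l) \<uplus>\<^sub>G copies \<kappa> (complete_graph 1)
                \<uplus>\<^sub>G copies ((l - \<kappa>) div 2) (complete_graph 2)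
            \<and> iso_verts f ` verts G\<^sub>1 = Inl ` verts (complete_graph (n - l)))))"
proof -
  let ?S = "graph_spectrum G"
  define d where "d = 2 * real m\<^sub>1 / real n\<^sub>1"
  have sub: "verts G\<^sub>1 \<subseteq> verts G" by (rule component_verts_subset[OF G G1])
  have "?S \<noteq> {#}"
  proof
    assume "?S = {#}"
    then have "card (verts G) = 0" using size_graph_spectrum[OF G] by simp
    then show False using card_mono[OF graph_finite_verts[OF G] sub] n1 by simp
  qed
  then have lam: "lambda\<^sub>1 \<in># ?S"
    unfolding lambda1 largest_eigenvalue_graph_spectrum[OF G] by (intro Max_in) auto
  have lam_max: "\<mu> \<le> lambda\<^sub>1" if "\<mu> \<in># ?S" for \<mu>
    unfolding lambda1 largest_eigenvalue_graph_spectrum[OF G] using that by (intro Max_ge) auto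
  have "n\<^sub>1 \<le> 2 * m\<^sub>1" using card_component_le_edges[OF G G1] n1 m1 by simp
  then have d1: "1 \<le> d" using n1(2) by (simp add: d_def)
  have d_le: "d \<le> lambda\<^sub>1"
    using average_degree_le[OF G G1 lam_max] n1 m1 by (simp add: d_def divide_le_eq)
  have b: "bound = d + real (card (verts G)) - real (nullity G) - 1
      + ln (cmod (Upsilon (card (verts G) - nullity G) (adjacency_matrix G))) - ln d"
    by (simp add: bound d_def n kappa)
  note energy = energy_lower_bound[OF G lam d1 d_le, folded b]
  have regular: "energy G \<ge> real r + real n - real \<kappa> - 1
      + ln (cmod (Upsilon (n - \<kappa>) (adjacency_matrix G))) - ln (real r)"
    if "regular_graph r G\<^sub>1" for r
  proof -
    have "2 * m\<^sub>1 = n\<^sub>1 * r" using regular_component_edges[OF G G1 that] n1 m1 by simp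
    then have "2 * real m\<^sub>1 = real n\<^sub>1 * real r" by (metis of_nat_mult of_nat_numeral)
    then have "d = real r" using n1(2) by (simp add: d_def)
    then show ?thesis using energy(1) by (simp add: b n kappa)
  qed
  have one: "energy G = bound \<longleftrightarrow>
      digraph_iso G (copies ((n - \<kappa>) div 2) (complete_graph 2) \<uplus>\<^sub>G copies \<kappa> (complete_graph 1))"
    if "lambda\<^sub>1 = 1"
  proof -
    note matching = matching_of_spectrum_le_1[OF G lam_max[unfolded that]]
    have "digraph_iso G (copies ((n - \<kappa>) div 2) (complete_graph 2) \<uplus>\<^sub>G copies \<kappa> (complete_graph 1))"
      using matching_isomorphism[OF G matching(1)] matching(2) by (simp add: n kappa)
    \<comment> \<open>Here d is squeezed between 1 and \<open>lambda\<^sub>1 = 1\<close>, and the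
      whole spectrum lies in {-1, 0, 1}, so both equality conditions hold.\<close>
    moreover have "energy G = bound"
      using d1 d_le that matching(3) unfolding energy(2) by (auto dest!: in_diffD)
    ultimately show ?thesis by blast
  qed
  have clique: "energy G = bound \<longleftrightarrow>
      (\<exists>l f. \<kappa> \<le> l \<and> l + 3 \<le> n
        \<and> pre_digraph.digraph_isomorphism G f
        \<and> app_iso f G = complete_graph (n - l) \<uplus>\<^sub>G copies \<kappa> (complete_graph 1)
            \<uplus>\<^sub>G copies ((l - \<kappa>) div 2) (complete_graph 2)
        \<and> iso_verts f ` verts G\<^sub>1 = Inl ` verts (complete_graph (n - l)))" (is "_ \<longleftrightarrow> ?R")
    if gt: "lambda\<^sub>1 > 1"
  proof
    assume "energy G = bound"
    then have avg: "d = lambda\<^sub>1"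
      and unit: "\<And>y. y \<in># ?S - {#lambda\<^sub>1#} \<Longrightarrow> y \<in> {-1, 0, 1}"
      using energy(2) by auto
    have "2 * real (card (edges G\<^sub>1)) / real (card (verts G\<^sub>1)) = lambda\<^sub>1"
      using avg by (simp add: d_def n1(1) m1)
    then have cm: "clique_and_matching G (verts G\<^sub>1)" "card (verts G\<^sub>1) \<ge> 3"
        "card (isolated G) = nullity G"
      using clique_component_of_spectrum[OF G G1 lam gt] unit by blast+
    have ne1: "card (verts G\<^sub>1) \<noteq> 1" using cm(2) by simp
    obtain f where f: "pre_digraph.digraph_isomorphism G f"
      "app_iso f G = complete_graph n\<^sub>1 \<uplus>\<^sub>G copies \<kappa> (complete_graph 1)
        \<uplus>\<^sub>G copies ((n - n\<^sub>1 - \<kappa>) div 2) (complete_graph 2)"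
      "iso_verts f ` verts G\<^sub>1 = Inl ` verts (complete_graph n\<^sub>1)"
      using clique_and_matching_isomorphism[OF G cm(1) ne1] unfolding n1(1) n kappa cm(3) by metis
    have le: "n\<^sub>1 + \<kappa> \<le> n"
      using clique_and_matching_card_verts[OF G cm(1) ne1] by (simp add: cm(3) n n1(1) kappa)
    \<comment> \<open>The witness for l is n - \<open>n\<^sub>1\<close>, the number of vertices
      outside the clique.\<close>
    have "n - (n - n\<^sub>1) = n\<^sub>1" "\<kappa> \<le> n - n\<^sub>1" "n - n\<^sub>1 + 3 \<le> n"
      using le cm(2) by (auto simp: n1(1))
    then show ?R by (intro exI[of _ "n - n\<^sub>1"] exI[of _ f]) (simp add: f)
  next
    assume ?R
    then obtain l f where l: "\<kappa> \<le> l" "l + 3 \<le> n" and f: "pre_digraph.digraph_isomorphism G f"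
      "app_iso f G = complete_graph (n - l) \<uplus>\<^sub>G copies \<kappa> (complete_graph 1)
            \<uplus>\<^sub>G copies ((l - \<kappa>) div 2) (complete_graph 2)"
      "iso_verts f ` verts G\<^sub>1 = Inl ` verts (complete_graph (n - l))" by blast
    have "n - l \<noteq> 1" using l by simp
    note cm = clique_and_matching_of_isomorphism[OF G f(1) sub f(2,3) this]
    have n3: "card (verts G\<^sub>1) \<ge> 3" using cm(2) l by simp
    have "card (isolated G) = nullity G" using cm(3) by (simp add: kappa)
    note spec = clique_and_matching_unit_spectrum[OF G cm(1) n3 this]
    define c where "c = real (card (verts G\<^sub>1)) - 1"
    \<comment> \<open>All eigenvalues other than the one copy of c are at most 1, so an eigenvalue
      above 1 must be c.\<close>
    have "lambda\<^sub>1 = c"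
    proof (rule ccontr)
      assume "lambda\<^sub>1 \<noteq> c"
      then have "lambda\<^sub>1 \<in># ?S - {#c#}" using lam by (simp add: in_diff_count)
      then show False using spec(2) gt unfolding c_def by force
    qed
    moreover have "d = c"
    proof -
      have "{(u, v). u \<rightarrow>\<^bsub>G\<^sub>1\<^esub> v} = {(u, v). u \<in> verts G\<^sub>1 \<and> v \<in> verts G\<^sub>1 \<and> v \<noteq> u}"
        using cm(1) by (auto simp: component_adj_iff[OF G G1] clique_and_matching_def)
      then have "2 * m\<^sub>1 = n\<^sub>1 * (n\<^sub>1 - 1)"
        using card_component_adj_pairs[OF G G1] card_distinct_pairs[OF finite_component[OF G G1]]
        by (simp add: n1(1) m1)
      then have "2 * real m\<^sub>1 = real n\<^sub>1 * real (n\<^sub>1 - 1)" by (metis of_nat_mult of_nat_numeral)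
      then show ?thesis using n1 by (simp add: d_def c_def of_nat_diff)
    qed
    ultimately show "energy G = bound" unfolding energy(2) using spec(2) by (simp add: c_def)
  qed
  show ?thesis using energy(1) regular one clique by blast
qed

end
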